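(* Let $n\geq 3$. Then the $n$-qubit Pauli group $\mathcal{P}_n$ is the only non-trivial proper normal subgroup of the $n$-qubit Clifford group $\mathcal{C}_n$ (both taken modulo global phase).
   Context: Let $I_2$ be the $2\times 2$ identity matrix, $X=\begin{pmatrix}0&1\\1&0\end{pmatrix}$, $Y=\begin{pmatrix}0&-i\\ i&0\end{pmatrix}$, $Z=\begin{pmatrix}1&0\\0&-1\end{pmatrix}$. Let $\hat{\mathcal{P}}_n=\{\sigma_1\otimes\cdots\otimes\sigma_n : \sigma_k\in\{I_2,X,Y,Z\}\}$, a set of unitary $2^n\times 2^n$ complex matrices, and let $\langle\hat{\mathcal{P}}_n\rangle$ be the subgroup of the unitary group $U(2^n)$ that it generates. The $n$-qubit Clifford group $\mathcal{C}_n$ is the group of all $A\in U(2^n)$ such that $A\sigma A^{-1}\in\langle\hat{\mathcal{P}}_n\rangle$ for all $\sigma\in\langle\hat{\mathcal{P}}_n\rangle$, modulo the subgroup of scalar unitary matrices (the global phase). It is a finite group of order $2^{n^2+2n}\prod_{j=1}^n(2^{2j}-1)$. The $n$-qubit Pauli group $\mathcal{P}_n$ is $\langle\hat{\mathcal{P}}_n\rangle$ modulo its center $\{c I_2^{\otimes n}: c\in\{\pm1,\pm i\}\}$; it is an abelian group of order $4^n$, identified with the image of $\langle\hat{\mathcal{P}}_n\rangle$ in $\mathcal{C}_n$. *)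

theory Defs
  imports
    "HOL-Algebra.Coset"
    "HOL-Algebra.Generated_Groups"
    "Jordan_Normal_Form.Schur_Decomposition"
begin

definition pauli_X :: "complex mat" where
  "pauli_X = mat_of_rows_list 2 [[0, 1], [1, 0]]"

definition pauli_Y :: "complex mat" where
  "pauli_Y = mat_of_rows_list 2 [[0, - \<i>], [\<i>, 0]]"

definition pauli_Z :: "complex mat" where
  "pauli_Z = mat_of_rows_list 2 [[1, 0], [0, - 1]]"

text \<open>Kronecker product, with the row (column) index of the left factor as the more significant
  part of the combined index.\<close>

definition kronecker :: "complex mat \<Rightarrow> complex mat \<Rightarrow> complex mat" where
  "kronecker A B = mat (dim_row A * dim_row B) (dim_col A * dim_col B)
     (\<lambda>(i, j). A $$ (i div dim_row B, j div dim_col B) * B $$ (i mod dim_row B, j mod dim_col B))"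

text \<open>The $1 \times 1$ identity is the unit of the Kronecker product, so this is
  $\sigma_1 \otimes \cdots \otimes \sigma_n$ for the list $[\sigma_1, \ldots, \sigma_n]$.\<close>

definition kronecker_list :: "complex mat list \<Rightarrow> complex mat" where
  "kronecker_list \<sigma>s = foldr kronecker \<sigma>s (1\<^sub>m 1)"

definition pauli_strings :: "nat \<Rightarrow> complex mat set" where
  "pauli_strings n =
     {kronecker_list \<sigma>s | \<sigma>s. length \<sigma>s = n \<and> set \<sigma>s \<subseteq> {1\<^sub>m 2, pauli_X, pauli_Y, pauli_Z}}"

definition unitary_group :: "nat \<Rightarrow> complex mat monoid" where
  "unitary_group N =
     \<lparr>carrier = {A \<in> carrier_mat N N. A * mat_adjoint A = 1\<^sub>m N \<and> mat_adjoint A * A = 1\<^sub>m N},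
      monoid.mult = (*), one = 1\<^sub>m N\<rparr>"

definition pauli_unitaries :: "nat \<Rightarrow> complex mat set" where
  "pauli_unitaries n = generate (unitary_group (2 ^ n)) (pauli_strings n)"

definition clifford_unitaries :: "nat \<Rightarrow> complex mat set" where
  "clifford_unitaries n =
     {A \<in> carrier (unitary_group (2 ^ n)). \<forall>\<sigma> \<in> pauli_unitaries n.
        A \<otimes>\<^bsub>unitary_group (2 ^ n)\<^esub> \<sigma> \<otimes>\<^bsub>unitary_group (2 ^ n)\<^esub> inv\<^bsub>unitary_group (2 ^ n)\<^esub> A
          \<in> pauli_unitaries n}"

definition global_phases :: "nat \<Rightarrow> complex mat set" where
  "global_phases n = {c \<cdot>\<^sub>m 1\<^sub>m (2 ^ n) | c. cmod c = 1}"

definition clifford_group :: "nat \<Rightarrow> complex mat set monoid" where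
  "clifford_group n = (unitary_group (2 ^ n)\<lparr>carrier := clifford_unitaries n\<rparr>) Mod global_phases n"

text \<open>The Pauli group modulo its center, realised inside the Clifford group as the set of phase
  cosets of its elements: two elements of \<open>pauli_unitaries n\<close> lie in the same
  phase coset iff they differ by a factor in $\{\pm 1, \pm i\}$.\<close>

definition pauli_group :: "nat \<Rightarrow> complex mat set set" where
  "pauli_group n = (\<lambda>A. global_phases n #>\<^bsub>unitary_group (2 ^ n)\<^esub> A) ` pauli_unitaries n"

end

theory Submission
  imports Defs
begin

text \<open>
  Modulo phases, two Pauli strings commute or anticommute, and the anticommutation relation
  makes the Pauli group \<open>P\<close>, an elementary abelian group of order \<open>4 ^ n\<close>, a nondegenerate
  symplectic space over the field with two elements. The Clifford group \<open>G\<close> acts on it by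
  conjugation. The kernel of the action is \<open>P\<close> itself, because a matrix commuting with all
  strings up to scalars is a multiple of a string (\<open>pauli_projective_commutant\<close>), and
  conjugation by \<open>(1 + i s) / sqrt 2\<close> is the transvection with centre \<open>s\<close> (\<open>pauli_rotation\<close>).
  Only these facts about matrices enter the argument; they are collected in the locale
  \<open>symplectic_extension\<close>, and the rest is group theory in that locale.

  A nontrivial normal subgroup \<open>N\<close> contains \<open>P\<close>: commutators bring it into \<open>P\<close>, on which the
  transvections act irreducibly (\<open>normal_subgroup_contains_P\<close>). Suppose that \<open>N\<close> is larger than
  \<open>P\<close>. An element of \<open>N\<close> outside \<open>P\<close> moves some vector \<open>v\<close> to a different \<open>v'\<close>, and then the
  transvections with centres \<open>v\<close> and \<open>v'\<close> agree modulo \<open>N\<close>. Having equal transvections modulo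
  \<open>N\<close> is an invariant equivalence relation on the nonzero vectors, and the action on these is
  primitive, so all transvections agree modulo \<open>N\<close> (\<open>\<tau>_constant\<close>). Their common value has order
  at most two, and its seventh power is trivial because the seven transvections of a totally
  isotropic space of dimension three multiply to one modulo \<open>P\<close> (\<open>seven_transvections\<close>); such a
  space exists exactly when \<open>n\<close> is at least three. So \<open>N\<close> contains all transvections, and these
  generate \<open>G\<close> modulo \<open>P\<close> (\<open>transvections_generate\<close>).
\<close>

section \<open>Extensions of a symplectic space by a group generated by transvections\<close>

text \<open>\<open>P\<close> is a symplectic vector space over the field with two elements, written multiplicatively:
  a vector is an element of \<open>P\<close>, addition is \<open>\<otimes>\<close>, and \<open>\<omega>\<close> is the form, as a truth value. \<open>G\<close>
  acts on \<open>P\<close> by conjugation, hence by isometries; the last three assumptions say that the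
  image contains every transvection, that \<open>G\<close> modulo \<open>P\<close> acts faithfully, and that there is a
  totally isotropic subspace of dimension three; the inequations say that its generators \<open>u\<close>,
  \<open>v\<close> and \<open>w\<close> are linearly independent.\<close>
locale symplectic_extension = group G for G (structure) +
  fixes P :: "'a set" and \<omega> :: "'a \<Rightarrow> 'a \<Rightarrow> bool"
  assumes P_subgroup: "subgroup P G"
    and P_finite: "finite P"
    and P_square: "a \<in> P \<Longrightarrow> a \<otimes> a = \<one>"
    and P_conj: "\<lbrakk>g \<in> carrier G; a \<in> P\<rbrakk> \<Longrightarrow> g \<otimes> a \<otimes> inv g \<in> P"
    and form_mult: "\<lbrakk>a \<in> P; b \<in> P; c \<in> P\<rbrakk> \<Longrightarrow> \<omega> (a \<otimes> b) c \<longleftrightarrow> \<omega> a c \<noteq> \<omega> b c"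
    and form_sym: "\<lbrakk>a \<in> P; b \<in> P\<rbrakk> \<Longrightarrow> \<omega> a b \<longleftrightarrow> \<omega> b a"
    and form_alternating: "a \<in> P \<Longrightarrow> \<not> \<omega> a a"
    and form_nondegenerate: "\<lbrakk>a \<in> P; a \<noteq> \<one>\<rbrakk> \<Longrightarrow> \<exists>b\<in>P. \<omega> a b"
    and form_invariant: "\<lbrakk>g \<in> carrier G; a \<in> P; b \<in> P\<rbrakk> \<Longrightarrow>
          \<omega> (g \<otimes> a \<otimes> inv g) (g \<otimes> b \<otimes> inv g) \<longleftrightarrow> \<omega> a b"
    and ex_transvection: "a \<in> P \<Longrightarrow>
          \<exists>t\<in>carrier G. \<forall>b\<in>P. t \<otimes> b \<otimes> inv t = (if \<omega> a b then a \<otimes> b else b)"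
    and self_centralizing: "\<lbrakk>g \<in> carrier G; \<And>a. a \<in> P \<Longrightarrow> g \<otimes> a \<otimes> inv g = a\<rbrakk> \<Longrightarrow> g \<in> P"
    and ex_isotropic: "\<exists>u\<in>P. \<exists>v\<in>P. \<exists>w\<in>P. \<not> \<omega> u v \<and> \<not> \<omega> u w \<and> \<not> \<omega> v w \<and>
          u \<noteq> \<one> \<and> v \<noteq> \<one> \<and> u \<otimes> v \<noteq> \<one> \<and>
          w \<noteq> \<one> \<and> u \<otimes> w \<noteq> \<one> \<and> v \<otimes> w \<noteq> \<one> \<and> u \<otimes> v \<otimes> w \<noteq> \<one>"
begin

definition act :: "'a \<Rightarrow> 'a \<Rightarrow> 'a" where
  "act g a = g \<otimes> a \<otimes> inv g"

definition transvect :: "'a \<Rightarrow> 'a \<Rightarrow> 'a" where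
  "transvect a b = (if \<omega> a b then a \<otimes> b else b)"

definition transvection :: "'a \<Rightarrow> 'a" where
  "transvection a = (SOME t. t \<in> carrier G \<and> (\<forall>b\<in>P. act t b = transvect a b))"

lemma P_carrier [simp]: "a \<in> P \<Longrightarrow> a \<in> carrier G"
  using P_subgroup by (rule subgroup.mem_carrier)

lemma P_one [simp]: "\<one> \<in> P"
  using P_subgroup by (rule subgroup.one_closed)

lemma P_mult [simp]: "a \<in> P \<Longrightarrow> b \<in> P \<Longrightarrow> a \<otimes> b \<in> P"
  using P_subgroup by (rule subgroup.m_closed)

lemma P_inv [simp]: "a \<in> P \<Longrightarrow> inv a = a"
  by (simp add: P_square inv_equality)

lemma P_comm: "a \<in> P \<Longrightarrow> b \<in> P \<Longrightarrow> a \<otimes> b = b \<otimes> a"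
  by (metis P_carrier P_inv P_mult inv_mult_group)

lemma P_cancel: "a \<in> P \<Longrightarrow> b \<in> P \<Longrightarrow> a \<otimes> (a \<otimes> b) = b"
  by (metis P_carrier P_square l_one m_assoc)

lemma P_lcomm: "a \<in> P \<Longrightarrow> b \<in> P \<Longrightarrow> c \<in> P \<Longrightarrow> a \<otimes> (b \<otimes> c) = b \<otimes> (a \<otimes> c)"
  by (metis P_carrier P_comm m_assoc)

lemma P_assoc: "a \<in> P \<Longrightarrow> b \<in> P \<Longrightarrow> c \<in> P \<Longrightarrow> (a \<otimes> b) \<otimes> c = a \<otimes> (b \<otimes> c)"
  by (simp add: m_assoc)

lemmas P_simps = P_assoc P_comm P_lcomm P_cancel P_square

lemma P_mult_eq_one: "a \<in> P \<Longrightarrow> b \<in> P \<Longrightarrow> a \<otimes> b = \<one> \<longleftrightarrow> a = b"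
  by (metis P_carrier P_square inv_equality P_inv)

lemma P_mult_eq_self: "a \<in> P \<Longrightarrow> b \<in> P \<Longrightarrow> a \<otimes> b = b \<longleftrightarrow> a = \<one>"
  by simp

lemma form_mult_right:
  "\<lbrakk>a \<in> P; b \<in> P; c \<in> P\<rbrakk> \<Longrightarrow> \<omega> c (a \<otimes> b) \<longleftrightarrow> \<omega> c a \<noteq> \<omega> c b"
  by (metis P_mult form_mult form_sym)

lemma form_one [simp]: "a \<in> P \<Longrightarrow> \<not> \<omega> \<one> a" "a \<in> P \<Longrightarrow> \<not> \<omega> a \<one>"
  by (metis P_one P_square form_mult P_mult form_sym)+

text \<open>If \<open>a\<close> pairs nontrivially with \<open>u\<close> and \<open>b\<close> with \<open>v\<close>, then one of \<open>a\<close>, \<open>b\<close> and \<open>a \<otimes> b\<close> pairs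
  nontrivially with both.\<close>
lemma ex_pairing_both:
  assumes "u \<in> P" "v \<in> P" "u \<noteq> \<one>" "v \<noteq> \<one>"
  shows "\<exists>w\<in>P. \<omega> w u \<and> \<omega> w v"
proof -
  obtain a b where ab: "a \<in> P" "\<omega> u a" "b \<in> P" "\<omega> v b"
    using form_nondegenerate[of u] form_nondegenerate[of v] assms by blast
  then have "\<omega> a u" "\<omega> b v"
    using form_sym[OF assms(1) ab(1)] form_sym[OF assms(2) ab(3)] by iprover+
  moreover from this have "\<omega> (a \<otimes> b) u \<longleftrightarrow> \<not> \<omega> b u" "\<omega> (a \<otimes> b) v \<longleftrightarrow> \<not> \<omega> a v"
    using assms ab by (simp_all add: form_mult)
  ultimately show ?thesis using ab P_mult by blast
qed

lemma ex_pairing_separating: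
  assumes "u \<in> P" "v \<in> P" "v \<noteq> \<one>" "u \<noteq> v"
  shows "\<exists>w\<in>P. \<not> \<omega> w u \<and> \<omega> w v"
proof (cases "u = \<one>")
  case True
  obtain w where "w \<in> P" "\<omega> v w" using assms form_nondegenerate by blast
  then have "\<omega> w v" "\<not> \<omega> w u" using assms True form_sym[of v w] form_one(2)[of w] by blast+
  then show ?thesis using \<open>w \<in> P\<close> by blast
next
  case False
  then obtain w where "w \<in> P" "\<omega> w v" "\<omega> w (u \<otimes> v)"
    using ex_pairing_both[of v "u \<otimes> v"] assms P_mult_eq_one by auto
  then show ?thesis
    using assms form_mult_right[of u v w] by auto
qed

lemma act_P [simp]: "g \<in> carrier G \<Longrightarrow> a \<in> P \<Longrightarrow> act g a \<in> P"
  unfolding act_def by (rule P_conj)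

lemma act_mult: "g \<in> carrier G \<Longrightarrow> h \<in> carrier G \<Longrightarrow> a \<in> P \<Longrightarrow> act (g \<otimes> h) a = act g (act h a)"
  by (simp add: act_def m_assoc inv_mult_group)

lemma act_distrib: "g \<in> carrier G \<Longrightarrow> a \<in> P \<Longrightarrow> b \<in> P \<Longrightarrow> act g (a \<otimes> b) = act g a \<otimes> act g b"
  by (simp add: act_def m_assoc inv_solve_left)

lemma act_one_left [simp]: "a \<in> P \<Longrightarrow> act \<one> a = a"
  by (simp add: act_def)

lemma act_by_P: "p \<in> P \<Longrightarrow> a \<in> P \<Longrightarrow> act p a = a"
  by (simp add: act_def P_simps)

lemma act_inv: "g \<in> carrier G \<Longrightarrow> a \<in> P \<Longrightarrow> act (inv g) (act g a) = a"
  by (metis act_mult act_one_left inv_closed l_inv)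

lemma act_inv': "g \<in> carrier G \<Longrightarrow> a \<in> P \<Longrightarrow> act g (act (inv g) a) = a"
  by (metis act_mult act_one_left inv_closed r_inv)

lemma act_one [simp]: "g \<in> carrier G \<Longrightarrow> act g \<one> = \<one>"
  by (simp add: act_def)

lemma act_eq_one_iff: "g \<in> carrier G \<Longrightarrow> a \<in> P \<Longrightarrow> act g a = \<one> \<longleftrightarrow> a = \<one>"
  by (metis act_inv act_one inv_closed)

lemma form_act: "g \<in> carrier G \<Longrightarrow> a \<in> P \<Longrightarrow> b \<in> P \<Longrightarrow> \<omega> (act g a) (act g b) \<longleftrightarrow> \<omega> a b"
  unfolding act_def by (rule form_invariant)

lemma transvect_P [simp]: "a \<in> P \<Longrightarrow> b \<in> P \<Longrightarrow> transvect a b \<in> P"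
  by (simp add: transvect_def)

lemma transvection:
  assumes "a \<in> P"
  shows transvection_closed [simp]: "transvection a \<in> carrier G"
    and act_transvection: "b \<in> P \<Longrightarrow> act (transvection a) b = transvect a b"
proof -
  have "\<exists>t. t \<in> carrier G \<and> (\<forall>b\<in>P. act t b = transvect a b)"
    using ex_transvection[OF assms] unfolding act_def transvect_def by blast
  then have "transvection a \<in> carrier G \<and> (\<forall>b\<in>P. act (transvection a) b = transvect a b)"
    unfolding transvection_def by (rule someI_ex)
  then show "transvection a \<in> carrier G" "b \<in> P \<Longrightarrow> act (transvection a) b = transvect a b"
    by auto
qed

lemma act_transvect:
  assumes "g \<in> carrier G" "a \<in> P" "b \<in> P"
  shows "act g (transvect a b) = transvect (act g a) (act g b)"
  unfolding transvect_def form_act[OF assms] using act_distrib[OF assms] by presburger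

text \<open>This is how every identity modulo \<open>P\<close> is obtained below: it suffices to compare the actions
  on \<open>P\<close>.\<close>
lemma same_action_imp_coset:
  assumes "g \<in> carrier G" "h \<in> carrier G" "\<And>a. a \<in> P \<Longrightarrow> act g a = act h a"
  shows "inv h \<otimes> g \<in> P"
proof (rule self_centralizing)
  show "inv h \<otimes> g \<in> carrier G" using assms by simp
  fix a assume "a \<in> P"
  then have "act (inv h \<otimes> g) a = a"
    using assms by (simp add: act_mult act_inv)
  then show "inv h \<otimes> g \<otimes> a \<otimes> inv (inv h \<otimes> g) = a"
    by (simp add: act_def)
qed

lemma transvection_not_P:
  assumes "a \<in> P" "a \<noteq> \<one>"
  shows "transvection a \<notin> P"
proof
  assume "transvection a \<in> P"
  obtain b where b: "b \<in> P" "\<omega> a b" using assms form_nondegenerate by blast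
  then have "a \<otimes> b = b"
    using act_by_P[OF \<open>transvection a \<in> P\<close>, of b] assms(1) by (simp add: act_transvection transvect_def)
  then show False using assms b by (simp add: P_mult_eq_self)
qed

lemma isotropic_triple:
  obtains u v w where "u \<in> P" "v \<in> P" "w \<in> P" "\<not> \<omega> u v" "\<not> \<omega> u w" "\<not> \<omega> v w"
    "u \<noteq> \<one>" "v \<noteq> \<one>" "u \<otimes> v \<noteq> \<one>" "w \<noteq> \<one>" "u \<otimes> w \<noteq> \<one>" "v \<otimes> w \<noteq> \<one>" "u \<otimes> v \<otimes> w \<noteq> \<one>"
proof -
  from ex_isotropic show thesis
  proof (elim bexE conjE)
    fix u v w
    assume "u \<in> P" "v \<in> P" "w \<in> P" "\<not> \<omega> u v" "\<not> \<omega> u w" "\<not> \<omega> v w"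
      "u \<noteq> \<one>" "v \<noteq> \<one>" "u \<otimes> v \<noteq> \<one>" "w \<noteq> \<one>" "u \<otimes> w \<noteq> \<one>" "v \<otimes> w \<noteq> \<one>" "u \<otimes> v \<otimes> w \<noteq> \<one>"
    then show thesis by (rule that)
  qed
qed

text \<open>\<open>P\<close> is the unique minimal normal subgroup. It is self-centralizing, so a nontrivial element
  of \<open>N\<close> either lies in \<open>P\<close> or has a nontrivial commutator with some element of \<open>P\<close>; either way
  \<open>N\<close> contains a nonzero vector \<open>u\<close>. A transvection with centre \<open>y\<close> moves \<open>x\<close> to \<open>y \<otimes> x\<close> when
  \<open>\<omega> x y\<close>, so membership in \<open>N\<close> spreads along nonorthogonal pairs, and any two nonzero vectors
  have a common nonorthogonal neighbour.\<close>
lemma normal_subgroup_contains_P: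
  assumes "N \<lhd> G" "N \<noteq> {\<one>}"
  shows "P \<subseteq> N"
proof -
  interpret N: normal N G by fact
  have conj: "act g a \<in> N" if "g \<in> carrier G" "a \<in> N" for g a
    using that by (simp add: act_def N.inv_op_closed2)
  obtain g where g: "g \<in> N" "g \<noteq> \<one>" using assms(2) N.one_closed by blast
  have gG: "g \<in> carrier G" using g by simp
  obtain u where u: "u \<in> P" "u \<in> N" "u \<noteq> \<one>"
  proof (cases "g \<in> P")
    case True
    then show ?thesis using g that by blast
  next
    case False
    then obtain a where a: "a \<in> P" "act g a \<noteq> a"
      using self_centralizing[OF gG] unfolding act_def by blast
    \<comment> \<open>the commutator of \<open>g\<close> and \<open>a\<close>, which lies in both \<open>N\<close> and \<open>P\<close>\<close>
    have "act g a \<otimes> a = g \<otimes> act a (inv g)"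
      using a gG by (simp add: act_def m_assoc)
    also have "\<dots> \<in> N" using conj[of a "inv g"] a g by simp
    finally show ?thesis using that[of "act g a \<otimes> a"] a gG by (simp add: P_mult_eq_one)
  qed
  have step: "y \<in> N" if "x \<in> P" "x \<in> N" "y \<in> P" "\<omega> x y" for x y
  proof -
    have "y \<otimes> x = act (transvection y) x"
      using that form_sym by (simp add: act_transvection transvect_def)
    also have "\<dots> \<in> N" using that conj by simp
    finally have "y \<otimes> x \<otimes> x \<in> N" using that by simp
    then show "y \<in> N" using that by (simp add: P_assoc P_square)
  qed
  show ?thesis
  proof
    fix y assume y: "y \<in> P"
    show "y \<in> N"
    proof (cases "y = \<one>")
      case False
      then obtain w where "w \<in> P" "\<omega> w u" "\<omega> w y" using ex_pairing_both[OF u(1) y u(3)] by blast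
      then show ?thesis using step u y form_sym by metis
    qed simp
  qed
qed

end

text \<open>The intended \<open>Q\<close> is the quotient by a normal subgroup that contains \<open>P\<close>. Working with the
  homomorphism turns congruences modulo that subgroup into equations.\<close>
locale symplectic_quotient = symplectic_extension G P \<omega> + group_hom G Q \<pi>
  for G (structure) and P \<omega> and Q (structure) and \<pi> +
  assumes kills_P: "p \<in> P \<Longrightarrow> \<pi> p = \<one>\<^bsub>Q\<^esub>"
begin

text \<open>Modulo \<open>P\<close> a transvection depends on its centre only, so the choice made in \<open>transvection\<close>
  disappears here.\<close>
definition \<tau> where
  "\<tau> a = \<pi> (transvection a)"

lemma same_action_imp_eq:
  assumes "g \<in> carrier G" "h \<in> carrier G" "\<And>a. a \<in> P \<Longrightarrow> act g a = act h a"
  shows "\<pi> g = \<pi> h"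
proof -
  have "\<pi> (inv h \<otimes> g) = \<one>\<^bsub>Q\<^esub>"
    using same_action_imp_coset[OF assms] kills_P by blast
  then have "\<pi> (h \<otimes> (inv h \<otimes> g)) = \<pi> h"
    using assms by (subst hom_mult) auto
  then show ?thesis using assms by (simp add: inv_solve_left m_assoc[symmetric])
qed

lemma \<tau>_closed [simp]: "a \<in> P \<Longrightarrow> \<tau> a \<in> carrier Q"
  by (simp add: \<tau>_def)

text \<open>Conjugating a transvection gives the transvection whose centre has been moved accordingly.
  Consequently the relation \<open>\<tau> u = \<tau> v\<close> on vectors is invariant under the isometries that \<open>G\<close>
  induces.\<close>
lemma \<tau>_act:
  assumes "g \<in> carrier G" "a \<in> P"
  shows "\<tau> (act g a) = \<pi> g \<otimes>\<^bsub>Q\<^esub> \<tau> a \<otimes>\<^bsub>Q\<^esub> inv\<^bsub>Q\<^esub> (\<pi> g)"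
proof -
  have "\<pi> (transvection (act g a)) = \<pi> (g \<otimes> transvection a \<otimes> inv g)"
  proof (rule same_action_imp_eq)
    fix b assume b: "b \<in> P"
    have "act (g \<otimes> transvection a \<otimes> inv g) b = transvect (act g a) (act g (act (inv g) b))"
      using assms b by (simp add: act_mult act_transvection act_transvect)
    then show "act (transvection (act g a)) b = act (g \<otimes> transvection a \<otimes> inv g) b"
      using assms b by (simp add: act_transvection act_inv')
  qed (use assms in auto)
  then show ?thesis using assms by (simp add: \<tau>_def)
qed

lemma \<tau>_transvect_cong:
  assumes "u \<in> P" "v \<in> P" "w \<in> P" "\<tau> u = \<tau> v"
  shows "\<tau> (transvect w u) = \<tau> (transvect w v)"
proof -
  have "\<tau> (transvect w x) =
      \<pi> (transvection w) \<otimes>\<^bsub>Q\<^esub> \<tau> x \<otimes>\<^bsub>Q\<^esub> inv\<^bsub>Q\<^esub> (\<pi> (transvection w))"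
    if "x \<in> P" for x
    using \<tau>_act[of "transvection w" x] act_transvection[of w x] transvection_closed[of w] assms(3) that
    by simp
  then show ?thesis using assms by simp
qed

lemma \<tau>_square:
  assumes "a \<in> P"
  shows "\<tau> a \<otimes>\<^bsub>Q\<^esub> \<tau> a = \<one>\<^bsub>Q\<^esub>"
proof -
  have "\<pi> (transvection a \<otimes> transvection a) = \<pi> \<one>"
    by (rule same_action_imp_eq)
      (use assms in \<open>auto simp: act_mult act_transvection transvect_def form_mult_right form_alternating P_cancel\<close>)
  then show ?thesis using assms by (simp add: \<tau>_def)
qed

text \<open>If all three pairs among \<open>u\<close>, \<open>v\<close> and \<open>x\<close> are nonorthogonal, the transvection with centre
  \<open>x \<otimes> v\<close> fixes \<open>u\<close> and moves \<open>v\<close> to \<open>x\<close>. If \<open>x\<close> is orthogonal to \<open>v\<close>, the same works after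
  replacing \<open>v\<close> by \<open>u \<otimes> v\<close>, its image under the transvection with centre \<open>u\<close>.\<close>
lemma nonorthogonal_spread:
  assumes "u \<in> P" "v \<in> P" "x \<in> P" "\<omega> u v" "\<tau> u = \<tau> v" "\<omega> x u"
  shows "\<tau> x = \<tau> u"
proof -
  have reach: "\<tau> x = \<tau> u" if v: "v \<in> P" "\<omega> u v" "\<tau> u = \<tau> v" "\<omega> x v" for v
  proof -
    have "\<omega> v u" using form_sym v assms by blast
    then have "\<not> \<omega> (x \<otimes> v) u" "\<omega> (x \<otimes> v) v"
      using v assms by (simp_all add: form_mult form_alternating)
    then have "transvect (x \<otimes> v) u = u" "transvect (x \<otimes> v) v = x"
      using v assms(3) by (auto simp: transvect_def P_assoc P_square)
    then show ?thesis using \<tau>_transvect_cong[of u v "x \<otimes> v"] v assms by simp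
  qed
  show ?thesis
  proof (cases "\<omega> x v")
    case True
    then show ?thesis using reach[of v] assms by blast
  next
    case False
    have "\<tau> u = \<tau> (u \<otimes> v)"
      using \<tau>_transvect_cong[of u v u] assms by (simp add: transvect_def form_alternating)
    then show ?thesis
      using reach[of "u \<otimes> v"] False assms by (simp add: form_mult_right form_alternating)
  qed
qed

text \<open>The action on nonzero vectors is primitive: an invariant equivalence relation with one
  nontrivial pair identifies everything. An orthogonal pair \<open>u\<close>, \<open>v\<close> produces a nonorthogonal
  one by a transvection that fixes \<open>u\<close> and moves \<open>v\<close>, after which the previous lemma reaches
  every vector in two steps.\<close>
lemma \<tau>_constant:
  assumes "u \<in> P" "v \<in> P" "u \<noteq> \<one>" "v \<noteq> \<one>" "u \<noteq> v" "\<tau> u = \<tau> v"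
    and "y \<in> P" "y \<noteq> \<one>"
  shows "\<tau> y = \<tau> v"
proof -
  obtain v' where v': "v' \<in> P" "\<omega> v v'" "\<tau> v = \<tau> v'"
  proof (cases "\<omega> u v")
    case True
    then show ?thesis using that[of u] assms form_sym by metis
  next
    case False
    obtain w where w: "w \<in> P" "\<not> \<omega> w u" "\<omega> w v"
      using ex_pairing_separating[of u v] assms by blast
    then have "\<tau> u = \<tau> (w \<otimes> v)"
      using \<tau>_transvect_cong[of u v w] assms by (simp add: transvect_def)
    moreover have "\<omega> v (w \<otimes> v)"
      using w assms form_sym by (simp add: form_mult_right form_alternating)
    ultimately show ?thesis using that[of "w \<otimes> v"] w assms by simp
  qed
  obtain w where w: "w \<in> P" "\<omega> w v" "\<omega> w y"
    using ex_pairing_both[of v y] assms by blast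
  have wv: "\<tau> w = \<tau> v"
    using nonorthogonal_spread[of v v' w] v' w assms by blast
  have "\<tau> y = \<tau> w"
    by (rule nonorthogonal_spread[of w v y]) (use w wv assms form_sym in auto)
  then show ?thesis using wv by simp
qed

text \<open>The seven transvections whose centres are the nonzero vectors of a totally isotropic space
  \<open>W\<close> of dimension three commute and multiply to an element acting trivially: \<open>b\<close> is moved by
  the sum of the vectors of \<open>W\<close> not orthogonal to it, and these are either none or the four
  points of an affine plane, whose sum is zero. An odd number of transvections multiplying to
  one is what makes the quotient perfect; in dimension four there is no such relation, the
  symplectic group being the symmetric group of degree six with the transvections odd.\<close>
lemma seven_transvections:
  assumes "u \<in> P" "v \<in> P" "w \<in> P" "\<not> \<omega> u v" "\<not> \<omega> u w" "\<not> \<omega> v w"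
  shows "\<tau> u \<otimes>\<^bsub>Q\<^esub> (\<tau> v \<otimes>\<^bsub>Q\<^esub> (\<tau> (u \<otimes> v) \<otimes>\<^bsub>Q\<^esub> (\<tau> w \<otimes>\<^bsub>Q\<^esub> (\<tau> (u \<otimes> w) \<otimes>\<^bsub>Q\<^esub>
           (\<tau> (v \<otimes> w) \<otimes>\<^bsub>Q\<^esub> \<tau> (u \<otimes> v \<otimes> w)))))) = \<one>\<^bsub>Q\<^esub>"
proof -
  let ?g = "transvection u \<otimes> (transvection v \<otimes> (transvection (u \<otimes> v) \<otimes> (transvection w \<otimes>
    (transvection (u \<otimes> w) \<otimes> (transvection (v \<otimes> w) \<otimes> transvection (u \<otimes> v \<otimes> w))))))"
  have "\<pi> ?g = \<pi> \<one>"
  proof (rule same_action_imp_eq)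
    fix b assume b: "b \<in> P"
    have sym: "\<not> \<omega> v u" "\<not> \<omega> w u" "\<not> \<omega> w v" using assms form_sym by auto
    have "act ?g b = transvect u (transvect v (transvect (u \<otimes> v) (transvect w
      (transvect (u \<otimes> w) (transvect (v \<otimes> w) (transvect (u \<otimes> v \<otimes> w) b))))))"
      using assms b by (simp add: act_mult act_transvection)
    also have "\<dots> = b"
      using assms b sym
      by (cases "\<omega> u b"; cases "\<omega> v b"; cases "\<omega> w b")
        (simp_all add: transvect_def form_mult form_mult_right form_alternating P_simps)
    finally show "act ?g b = act \<one> b" using b by simp
  qed (use assms in auto)
  then show ?thesis using assms by (simp add: \<tau>_def)
qed

text \<open>All seven factors in the previous lemma are now the same element, whose square is one, so it
  is one itself.\<close>
lemma \<tau>_trivial: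
  assumes "u \<in> P" "v \<in> P" "u \<noteq> \<one>" "v \<noteq> \<one>" "u \<noteq> v" "\<tau> u = \<tau> v"
    and "y \<in> P" "y \<noteq> \<one>"
  shows "\<tau> y = \<one>\<^bsub>Q\<^esub>"
proof -
  obtain a b c where abc: "a \<in> P" "b \<in> P" "c \<in> P" "\<not> \<omega> a b" "\<not> \<omega> a c" "\<not> \<omega> b c"
    "a \<noteq> \<one>" "b \<noteq> \<one>" "a \<otimes> b \<noteq> \<one>" "c \<noteq> \<one>" "a \<otimes> c \<noteq> \<one>" "b \<otimes> c \<noteq> \<one>"
    "a \<otimes> b \<otimes> c \<noteq> \<one>"
    by (rule isotropic_triple)
  have t: "\<tau> x = \<tau> v" if "x \<in> P" "x \<noteq> \<one>" for x
    using \<tau>_constant[OF assms(1-6)] that by blast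
  have "\<tau> v \<otimes>\<^bsub>Q\<^esub> (\<tau> v \<otimes>\<^bsub>Q\<^esub> (\<tau> v \<otimes>\<^bsub>Q\<^esub> (\<tau> v \<otimes>\<^bsub>Q\<^esub> (\<tau> v \<otimes>\<^bsub>Q\<^esub> (\<tau> v \<otimes>\<^bsub>Q\<^esub> \<tau> v))))) = \<one>\<^bsub>Q\<^esub>"
    using seven_transvections[OF abc(1-6)] abc
      t[of a] t[of b] t[of "a \<otimes> b"] t[of c] t[of "a \<otimes> c"] t[of "b \<otimes> c"] t[of "a \<otimes> b \<otimes> c"]
    by simp
  then have "\<tau> v = \<one>\<^bsub>Q\<^esub>"
    using \<tau>_square[OF assms(2)] assms(2) by simp
  then show ?thesis using t[of y] assms by simp
qed

text \<open>Every isometry is a product of transvections; the induction is on the number of vectors moved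
  by \<open>g\<close>. Write \<open>P\<close> additively. If \<open>\<omega> v (g v)\<close> for some \<open>v\<close>, the transvection with centre
  \<open>v + g v\<close> takes \<open>g v\<close> back to \<open>v\<close>, and it fixes all fixed vectors of \<open>g\<close>, because these are
  orthogonal to \<open>v + g v\<close>. If there is no such \<open>v\<close>, one preliminary transvection, with centre
  \<open>w = v + g v\<close> for any moved \<open>v\<close>, keeps the fixed vectors of \<open>g\<close> and makes some \<open>x\<close>
  nonorthogonal to its image.\<close>
lemma transvections_generate:
  assumes triv: "\<And>a. a \<in> P \<Longrightarrow> \<tau> a = \<one>\<^bsub>Q\<^esub>"
  shows "g \<in> carrier G \<Longrightarrow> \<pi> g = \<one>\<^bsub>Q\<^esub>"
proof (induction "card {v \<in> P. act g v \<noteq> v}" arbitrary: g rule: less_induct)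
  case less
  note gG = \<open>g \<in> carrier G\<close>
  have absorb: "\<pi> (transvection a \<otimes> h) = \<pi> h" if "a \<in> P" "h \<in> carrier G" for a h
    using that triv by (simp add: \<tau>_def)
  have act_T: "act (transvection a \<otimes> h) b = transvect a (act h b)" if "a \<in> P" "b \<in> P" "h \<in> carrier G" for a b h
    using that by (simp add: act_mult act_transvection)
  have fixes_more: "transvect (v \<otimes> act h v) (act h x) = x"
    if "h \<in> carrier G" "v \<in> P" "x \<in> P" "act h x = x" for h v x
  proof -
    have "\<omega> (act h v) x = \<omega> v x" using form_act[of h v x] that by simp
    then show ?thesis using that by (simp add: transvect_def form_mult)
  qed
  \<comment> \<open>\<open>h\<close> is \<open>g\<close> itself, or \<open>g\<close> after the preliminary transvection\<close>
  have reduce: "\<pi> h = \<one>\<^bsub>Q\<^esub>" if h: "h \<in> carrier G" "v \<in> P" "\<omega> v (act h v)"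
    "\<And>x. x \<in> P \<Longrightarrow> act g x = x \<Longrightarrow> act h x = x" "act g v \<noteq> v" for h v
  proof -
    let ?h = "transvection (v \<otimes> act h v) \<otimes> h"
    have "transvect (v \<otimes> act h v) (act h v) = v"
      using h by (simp add: transvect_def form_mult form_alternating P_simps)
    then have v: "act ?h v = v" using h by (simp add: act_T)
    have "{x \<in> P. act ?h x \<noteq> x} \<subset> {x \<in> P. act g x \<noteq> x}"
    proof
      show "{x \<in> P. act ?h x \<noteq> x} \<subseteq> {x \<in> P. act g x \<noteq> x}"
        using h fixes_more[of h v] by (auto simp: act_T)
      show "{x \<in> P. act ?h x \<noteq> x} \<noteq> {x \<in> P. act g x \<noteq> x}"
        using v h by blast
    qed
    then have "card {x \<in> P. act ?h x \<noteq> x} < card {x \<in> P. act g x \<noteq> x}"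
      using P_finite by (intro psubset_card_mono) auto
    then have "\<pi> ?h = \<one>\<^bsub>Q\<^esub>" using less(1)[of ?h] h by simp
    then show ?thesis using absorb h by simp
  qed
  show ?case
  proof (cases "\<exists>v\<in>P. \<omega> v (act g v)")
    case True
    then obtain v where v: "v \<in> P" "\<omega> v (act g v)" by blast
    then have "act g v \<noteq> v" using form_alternating by metis
    then show ?thesis using reduce[of g v] v gG by blast
  next
    case hyperbolic: False
    show ?thesis
    proof (cases "\<forall>v\<in>P. act g v = v")
      case True
      then have "\<pi> g = \<pi> \<one>" using gG by (intro same_action_imp_eq) auto
      then show ?thesis by simp
    next
      case False
      then obtain v where v: "v \<in> P" "act g v \<noteq> v" by blast
      define w where "w = v \<otimes> act g v"
      have w: "w \<in> P" "w \<noteq> \<one>"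
        using v gG unfolding w_def by (auto simp: P_mult_eq_one)
      then obtain x where x: "x \<in> P" "\<omega> x w" using form_nondegenerate form_sym by metis
      \<comment> \<open>polarization of \<open>\<not> \<omega> v (act g v)\<close>\<close>
      have "\<omega> x (act g v) \<longleftrightarrow> \<omega> v (act g x)"
      proof -
        have "\<not> \<omega> (x \<otimes> v) (act g (x \<otimes> v))" "\<not> \<omega> x (act g x)" "\<not> \<omega> v (act g v)"
          using hyperbolic x v by auto
        then show ?thesis using x v gG by (simp add: act_distrib form_mult form_mult_right)
      qed
      moreover have "\<omega> (act g v) (act g x) \<longleftrightarrow> \<omega> v x" using form_act gG x v by blast
      moreover have "\<omega> x v \<noteq> \<omega> x (act g v)"
        using x v gG unfolding w_def by (simp add: form_mult_right)
      moreover have "\<omega> x v \<longleftrightarrow> \<omega> v x" using form_sym x v by blast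
      ultimately have "\<omega> w (act g x)"
        using x v gG unfolding w_def by (simp add: form_mult)
      then have "transvect w (act g x) = w \<otimes> act g x" by (simp add: transvect_def)
      moreover have "\<not> \<omega> x (act g x)" using hyperbolic x by blast
      ultimately have "\<omega> x (act (transvection w \<otimes> g) x)"
        using x w gG by (simp add: act_T form_mult_right)
      moreover have "act g x \<noteq> x"
      proof
        assume "act g x = x"
        then have "transvect w (act g x) = x" using fixes_more[of g v x] gG v x by (simp add: w_def)
        then have "w \<otimes> x = x" using \<open>transvect w (act g x) = w \<otimes> act g x\<close> \<open>act g x = x\<close> by simp
        then show False using P_mult_eq_self w x by simp
      qed
      ultimately have "\<pi> (transvection w \<otimes> g) = \<one>\<^bsub>Q\<^esub>"
        using reduce[of "transvection w \<otimes> g" x] x w gG v fixes_more[of g v]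
        by (simp add: act_T w_def)
      then show ?thesis using absorb w gG by simp
    qed
  qed
qed

text \<open>An element \<open>g\<close> in the kernel but outside \<open>P\<close> moves some vector \<open>v\<close>, and its triviality in the
  quotient identifies \<open>\<tau> v\<close> with \<open>\<tau> (act g v)\<close>. This is the nontrivial pair that the
  primitivity argument needs.\<close>
lemma quotient_trivial:
  assumes "g \<in> carrier G" "g \<notin> P" "\<pi> g = \<one>\<^bsub>Q\<^esub>" "h \<in> carrier G"
  shows "\<pi> h = \<one>\<^bsub>Q\<^esub>"
proof -
  obtain v where v: "v \<in> P" "act g v \<noteq> v"
    using self_centralizing[of g] assms unfolding act_def by blast
  have eq: "\<tau> (act g v) = \<tau> v" using \<tau>_act[of g v] assms v by simp
  have ne: "v \<noteq> \<one>" "act g v \<noteq> \<one>" using v assms act_eq_one_iff by auto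
  have "\<tau> a = \<one>\<^bsub>Q\<^esub>" if "a \<in> P" for a
  proof (cases "a = \<one>")
    case True
    have "\<pi> (transvection \<one>) = \<pi> \<one>"
      by (rule same_action_imp_eq) (auto simp: act_transvection transvect_def)
    then show ?thesis using True by (simp add: \<tau>_def)
  next
    case False
    then show ?thesis using \<tau>_trivial[of "act g v" v a] that v ne eq assms by simp
  qed
  then show ?thesis using transvections_generate assms by blast
qed

end

theorem (in symplectic_extension) normal_subgroups:
  "{N. N \<lhd> G \<and> N \<noteq> {\<one>} \<and> N \<noteq> carrier G} = {P}"
proof -
  obtain u where u: "u \<in> P" "u \<noteq> \<one>"
    using isotropic_triple by metis
  have P_normal: "P \<lhd> G" by (simp add: normal_inv_iff P_subgroup P_conj)
  have P_nontrivial: "P \<noteq> {\<one>}" using u by blast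
  have P_proper: "P \<noteq> carrier G" using transvection_not_P[OF u] transvection_closed[OF u(1)] by metis
  have P_only: "N = P" if N: "N \<lhd> G" "N \<noteq> {\<one>}" "N \<noteq> carrier G" for N
  proof (rule ccontr)
    assume "N \<noteq> P"
    interpret N: normal N G by (rule N(1))
    have PN: "P \<subseteq> N" using normal_subgroup_contains_P N(1,2) .
    have in_N: "N #> h = \<one>\<^bsub>G Mod N\<^esub>" if "h \<in> N" for h
      using that by (simp add: N.rcos_const[OF is_group])
    have quotient: "symplectic_quotient G P \<omega> (G Mod N) (\<lambda>g. N #> g)"
    proof (intro symplectic_quotient.intro symplectic_quotient_axioms.intro group_hom.intro
        group_hom_axioms.intro)
      show "symplectic_extension G P \<omega>" by (rule symplectic_extension_axioms)
      show "group G" by (rule is_group)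
      show "group (G Mod N)" by (rule N.factorgroup_is_group)
      show "(\<lambda>g. N #> g) \<in> hom G (G Mod N)" by (rule N.r_coset_hom_Mod)
      show "N #> p = \<one>\<^bsub>G Mod N\<^esub>" if "p \<in> P" for p
        using that PN in_N by blast
    qed
    obtain g where g: "g \<in> N" "g \<notin> P" using \<open>N \<noteq> P\<close> PN by blast
    have "carrier G \<subseteq> N"
    proof
      fix h assume h: "h \<in> carrier G"
      have "N #> h = \<one>\<^bsub>G Mod N\<^esub>"
        using symplectic_quotient.quotient_trivial[OF quotient N.mem_carrier[OF g(1)] g(2) in_N[OF g(1)] h] .
      then show "h \<in> N" using rcos_self[OF h N.subgroup_axioms] by simp
    qed
    then show False using N(3) N.subset by (simp add: subset_antisym)
  qed
  show ?thesis
  proof (intro equalityI subsetI)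
    fix N assume "N \<in> {N. N \<lhd> G \<and> N \<noteq> {\<one>} \<and> N \<noteq> carrier G}"
    then show "N \<in> {P}" using P_only[of N] by simp
  next
    fix N assume "N \<in> {P}"
    then show "N \<in> {N. N \<lhd> G \<and> N \<noteq> {\<one>} \<and> N \<noteq> carrier G}"
      using P_normal P_nontrivial P_proper by simp
  qed
qed

section \<open>Unitary matrices\<close>

lemma mat_adjoint_dim [simp]:
  "dim_row (mat_adjoint A) = dim_col A" "dim_col (mat_adjoint A) = dim_row A"
  by (auto simp: mat_adjoint_def mat_of_rows_def)

lemma mat_adjoint_index [simp]:
  "i < dim_col A \<Longrightarrow> j < dim_row A \<Longrightarrow> mat_adjoint A $$ (i, j) = conjugate (A $$ (j, i))"
  by (simp add: mat_adjoint_def mat_of_rows_def)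

lemma mat_adjoint_carrier [simp]: "A \<in> carrier_mat m n \<Longrightarrow> mat_adjoint A \<in> carrier_mat n m"
  by auto

lemma mat_adjoint_adjoint [simp]: "mat_adjoint (mat_adjoint A) = A"
  by (intro eq_matI) auto

lemma mat_adjoint_mult:
  fixes A B :: "complex mat"
  assumes "A \<in> carrier_mat m n" "B \<in> carrier_mat n k"
  shows "mat_adjoint (A * B) = mat_adjoint B * mat_adjoint A"
  by (intro eq_matI) (use assms in \<open>auto simp: scalar_prod_def intro!: sum.cong\<close>)

lemma mat_adjoint_smult: "mat_adjoint (c \<cdot>\<^sub>m A :: complex mat) = cnj c \<cdot>\<^sub>m mat_adjoint A"
  by (intro eq_matI) auto

lemma mat_adjoint_add:
  fixes A B :: "complex mat"
  assumes "A \<in> carrier_mat m n" "B \<in> carrier_mat m n"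
  shows "mat_adjoint (A + B) = mat_adjoint A + mat_adjoint B"
  by (intro eq_matI) (use assms in auto)

lemma mat_adjoint_one [simp]: "mat_adjoint (1\<^sub>m n :: complex mat) = 1\<^sub>m n"
  by (intro eq_matI) auto

lemma unitary_group_simps [simp]:
  "A \<in> carrier (unitary_group N) \<longleftrightarrow>
     A \<in> carrier_mat N N \<and> A * mat_adjoint A = 1\<^sub>m N \<and> mat_adjoint A * A = 1\<^sub>m N"
  "monoid.mult (unitary_group N) = (*)"
  "\<one>\<^bsub>unitary_group N\<^esub> = 1\<^sub>m N"
  by (auto simp: unitary_group_def)

lemma unitary_mult_closed:
  assumes "A \<in> carrier (unitary_group N)" "B \<in> carrier (unitary_group N)"
  shows "A * B \<in> carrier (unitary_group N)"
proof -
  have A: "A \<in> carrier_mat N N" "mat_adjoint A \<in> carrier_mat N N"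
    "A * mat_adjoint A = 1\<^sub>m N" "mat_adjoint A * A = 1\<^sub>m N"
   and B: "B \<in> carrier_mat N N" "mat_adjoint B \<in> carrier_mat N N"
    "B * mat_adjoint B = 1\<^sub>m N" "mat_adjoint B * B = 1\<^sub>m N"
    using assms by auto
  have "(A * B) * (mat_adjoint B * mat_adjoint A) = A * ((B * mat_adjoint B) * mat_adjoint A)"
    using A(1,2) B(1,2) by (simp add: assoc_mult_mat[of _ N N _ N _ N] mult_carrier_mat[of _ N N _ N])
  moreover have "(mat_adjoint B * mat_adjoint A) * (A * B) = mat_adjoint B * ((mat_adjoint A * A) * B)"
    using A(1,2) B(1,2) by (simp add: assoc_mult_mat[of _ N N _ N _ N] mult_carrier_mat[of _ N N _ N])
  ultimately show ?thesis
    using A B by (simp add: mat_adjoint_mult[of _ N N _ N] mult_carrier_mat[of _ N N _ N])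
qed

lemma unitary_group_group: "group (unitary_group N)"
proof (rule groupI)
  fix A B C assume ABC: "A \<in> carrier (unitary_group N)" "B \<in> carrier (unitary_group N)"
    "C \<in> carrier (unitary_group N)"
  show "A \<otimes>\<^bsub>unitary_group N\<^esub> B \<otimes>\<^bsub>unitary_group N\<^esub> C
      = A \<otimes>\<^bsub>unitary_group N\<^esub> (B \<otimes>\<^bsub>unitary_group N\<^esub> C)"
    using ABC by (simp add: assoc_mult_mat[of _ N N _ N _ N])
next
  fix A assume "A \<in> carrier (unitary_group N)"
  then show "\<exists>B\<in>carrier (unitary_group N). B \<otimes>\<^bsub>unitary_group N\<^esub> A = \<one>\<^bsub>unitary_group N\<^esub>"
    by (intro bexI[of _ "mat_adjoint A"]) auto
qed (use unitary_mult_closed in auto)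

lemma unitary_group_inv:
  assumes "A \<in> carrier (unitary_group N)"
  shows "inv\<^bsub>unitary_group N\<^esub> A = mat_adjoint A"
  by (rule group.inv_equality[OF unitary_group_group]) (use assms in auto)

section \<open>Kronecker products\<close>

lemma kronecker_dim [simp]:
  "dim_row (kronecker A B) = dim_row A * dim_row B" "dim_col (kronecker A B) = dim_col A * dim_col B"
  by (simp_all add: kronecker_def)

lemma kronecker_carrier [simp]:
  "A \<in> carrier_mat a b \<Longrightarrow> B \<in> carrier_mat c d \<Longrightarrow> kronecker A B \<in> carrier_mat (a * c) (b * d)"
  by (auto intro!: carrier_matI)

lemma kronecker_index:
  "i < dim_row A * dim_row B \<Longrightarrow> j < dim_col A * dim_col B \<Longrightarrow> kronecker A B $$ (i, j) =
     A $$ (i div dim_row B, j div dim_col B) * B $$ (i mod dim_row B, j mod dim_col B)"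
  by (simp add: kronecker_def)

lemma div_mod_bounds:
  fixes i :: nat
  assumes "i < a * b"
  shows "i div b < a" "i mod b < b"
proof -
  have "0 < b" using assms by (cases b) auto
  then show "i div b < a" "i mod b < b" using assms by (auto simp: less_mult_imp_div_less)
qed

lemma mult_add_bound:
  fixes i j :: nat
  assumes "i < a" "j < b"
  shows "i * b + j < a * b"
proof -
  have "i * b + j < Suc i * b" using assms by simp
  also have "\<dots> \<le> a * b" using assms by (intro mult_right_mono) auto
  finally show ?thesis .
qed

lemma sum_div_mod:
  fixes f :: "nat \<Rightarrow> nat \<Rightarrow> 'a :: comm_monoid_add"
  shows "(\<Sum>k<a * b. f (k div b) (k mod b)) = (\<Sum>i<a. \<Sum>j<b. f i j)"
proof -
  have "(\<Sum>k<a * b. f (k div b) (k mod b)) = (\<Sum>(i, j)\<in>{..<a} \<times> {..<b}. f i j)"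
    by (rule sum.reindex_bij_witness[where i = "\<lambda>(i, j). i * b + j" and j = "\<lambda>k. (k div b, k mod b)"])
      (auto simp: div_mod_bounds less_mult_imp_div_less intro: mult_add_bound)
  then show ?thesis by (simp add: sum.cartesian_product)
qed

text \<open>The mixed-product rule. Row and column indices of a product are pairs of indices, so the sum
  over the middle index is a double sum, which factors.\<close>
lemma kronecker_mult:
  assumes "A \<in> carrier_mat a b" "C \<in> carrier_mat b c" "B \<in> carrier_mat a' b'" "D \<in> carrier_mat b' c'"
  shows "kronecker A B * kronecker C D = kronecker (A * C) (B * D)"
proof (intro eq_matI)
  fix i j assume "i < dim_row (kronecker (A * C) (B * D))" "j < dim_col (kronecker (A * C) (B * D))"
  then have ij: "i < a * a'" "j < c * c'" using assms by auto
  note b = div_mod_bounds[OF ij(1)] div_mod_bounds[OF ij(2)]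
  have "(kronecker A B * kronecker C D) $$ (i, j) =
      (\<Sum>k<b * b'. (A $$ (i div a', k div b') * B $$ (i mod a', k mod b')) *
                  (C $$ (k div b', j div c') * D $$ (k mod b', j mod c')))"
    using ij assms by (auto simp: scalar_prod_def kronecker_index atLeast0LessThan intro!: sum.cong)
  also have "\<dots> = (\<Sum>k<b. \<Sum>l<b'. (A $$ (i div a', k) * B $$ (i mod a', l)) * (C $$ (k, j div c') * D $$ (l, j mod c')))"
    by (rule sum_div_mod)
  also have "\<dots> = (\<Sum>k<b. A $$ (i div a', k) * C $$ (k, j div c')) * (\<Sum>l<b'. B $$ (i mod a', l) * D $$ (l, j mod c'))"
    by (simp add: sum_product mult_ac)
  also have "\<dots> = kronecker (A * C) (B * D) $$ (i, j)"
    using ij b assms by (simp add: scalar_prod_def kronecker_index atLeast0LessThan)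
  finally show "(kronecker A B * kronecker C D) $$ (i, j) = kronecker (A * C) (B * D) $$ (i, j)" .
qed (use assms in auto)

lemma kronecker_smult: "kronecker (c \<cdot>\<^sub>m A) (d \<cdot>\<^sub>m B) = (c * d) \<cdot>\<^sub>m kronecker A B"
proof (intro eq_matI)
  fix i j assume "i < dim_row ((c * d) \<cdot>\<^sub>m kronecker A B)" "j < dim_col ((c * d) \<cdot>\<^sub>m kronecker A B)"
  then have ij: "i < dim_row A * dim_row B" "j < dim_col A * dim_col B" by auto
  note b = div_mod_bounds[OF ij(1)] div_mod_bounds[OF ij(2)]
  show "kronecker (c \<cdot>\<^sub>m A) (d \<cdot>\<^sub>m B) $$ (i, j) = ((c * d) \<cdot>\<^sub>m kronecker A B) $$ (i, j)"
    using ij b by (simp add: kronecker_index)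
qed auto

lemma kronecker_adjoint: "mat_adjoint (kronecker A B) = kronecker (mat_adjoint A) (mat_adjoint B)"
proof (intro eq_matI)
  fix i j assume "i < dim_row (kronecker (mat_adjoint A) (mat_adjoint B))"
    "j < dim_col (kronecker (mat_adjoint A) (mat_adjoint B))"
  then have ij: "i < dim_col A * dim_col B" "j < dim_row A * dim_row B" by auto
  note b = div_mod_bounds[OF ij(1)] div_mod_bounds[OF ij(2)]
  show "mat_adjoint (kronecker A B) $$ (i, j) = kronecker (mat_adjoint A) (mat_adjoint B) $$ (i, j)"
    using ij b by (simp add: kronecker_index)
qed auto

lemma kronecker_one: "kronecker (1\<^sub>m a) (1\<^sub>m b) = 1\<^sub>m (a * b)"
proof (intro eq_matI)
  fix i j assume "i < dim_row (1\<^sub>m (a * b) :: complex mat)" "j < dim_col (1\<^sub>m (a * b) :: complex mat)"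
  then have ij: "i < a * b" "j < a * b" by auto
  note b = div_mod_bounds[OF ij(1)] div_mod_bounds[OF ij(2)]
  have "i = j \<longleftrightarrow> i div b = j div b \<and> i mod b = j mod b"
    by (metis div_mult_mod_eq)
  then show "kronecker (1\<^sub>m a) (1\<^sub>m b) $$ (i, j) = 1\<^sub>m (a * b) $$ (i, j)"
    using ij b by (auto simp: kronecker_index)
qed auto

section \<open>The single-qubit Pauli matrices\<close>

definition pauli_matrices :: "complex mat set" where
  "pauli_matrices = {1\<^sub>m 2, pauli_X, pauli_Y, pauli_Z}"

definition fourth_roots :: "complex set" where
  "fourth_roots = {1, -1, \<i>, -\<i>}"

lemma fourth_roots_mult: "c \<in> fourth_roots \<Longrightarrow> d \<in> fourth_roots \<Longrightarrow> c * d \<in> fourth_roots"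
  by (auto simp: fourth_roots_def)

lemma fourth_roots_norm: "c \<in> fourth_roots \<Longrightarrow> cmod c = 1"
  by (auto simp: fourth_roots_def)

lemma mat2_eqI:
  assumes "A \<in> carrier_mat 2 2" "B \<in> carrier_mat 2 2"
    "A $$ (0, 0) = B $$ (0, 0)" "A $$ (0, 1) = B $$ (0, 1)" "A $$ (1, 0) = B $$ (1, 0)" "A $$ (1, 1) = B $$ (1, 1)"
  shows "A = B"
  by (intro eq_matI) (use assms in \<open>auto simp: less_2_cases_iff\<close>)

lemma pauli_carrier [simp]:
  "pauli_X \<in> carrier_mat 2 2" "pauli_Y \<in> carrier_mat 2 2" "pauli_Z \<in> carrier_mat 2 2"
  by (auto simp: pauli_X_def pauli_Y_def pauli_Z_def mat_of_rows_list_def)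

lemma pauli_matrices_carrier: "a \<in> pauli_matrices \<Longrightarrow> a \<in> carrier_mat 2 2"
  by (auto simp: pauli_matrices_def)

lemma pauli_dim [simp]:
  "dim_row pauli_X = 2" "dim_row pauli_Y = 2" "dim_row pauli_Z = 2"
  "dim_col pauli_X = 2" "dim_col pauli_Y = 2" "dim_col pauli_Z = 2"
  using pauli_carrier by blast+

lemma pauli_entries [simp]:
  "pauli_X $$ (0, 0) = 0" "pauli_X $$ (0, Suc 0) = 1" "pauli_X $$ (Suc 0, 0) = 1" "pauli_X $$ (Suc 0, Suc 0) = 0"
  "pauli_Y $$ (0, 0) = 0" "pauli_Y $$ (0, Suc 0) = - \<i>" "pauli_Y $$ (Suc 0, 0) = \<i>" "pauli_Y $$ (Suc 0, Suc 0) = 0"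
  "pauli_Z $$ (0, 0) = 1" "pauli_Z $$ (0, Suc 0) = 0" "pauli_Z $$ (Suc 0, 0) = 0" "pauli_Z $$ (Suc 0, Suc 0) = -1"
  by (auto simp: pauli_X_def pauli_Y_def pauli_Z_def mat_of_rows_list_def)

lemma sum_upto_2: "sum f {0..<2::nat} = f 0 + f (Suc 0)"
  by (simp add: numeral_2_eq_2)

lemma pauli_mult:
  "pauli_X * pauli_X = 1\<^sub>m 2" "pauli_Y * pauli_Y = 1\<^sub>m 2" "pauli_Z * pauli_Z = 1\<^sub>m 2"
  "pauli_X * pauli_Y = \<i> \<cdot>\<^sub>m pauli_Z" "pauli_Y * pauli_X = (- \<i>) \<cdot>\<^sub>m pauli_Z"
  "pauli_Y * pauli_Z = \<i> \<cdot>\<^sub>m pauli_X" "pauli_Z * pauli_Y = (- \<i>) \<cdot>\<^sub>m pauli_X"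
  "pauli_Z * pauli_X = \<i> \<cdot>\<^sub>m pauli_Y" "pauli_X * pauli_Z = (- \<i>) \<cdot>\<^sub>m pauli_Y"
  by (auto intro!: mat2_eqI simp: scalar_prod_def sum_upto_2)

lemma pauli_matrices_hermitian: "a \<in> pauli_matrices \<Longrightarrow> mat_adjoint a = a"
  unfolding pauli_matrices_def by (elim insertE emptyE) (simp, (rule mat2_eqI; simp)+)

lemma pauli_matrices_square: "a \<in> pauli_matrices \<Longrightarrow> a * a = 1\<^sub>m 2"
  by (auto simp: pauli_matrices_def pauli_mult)

lemma smult_smult_mat: "c \<cdot>\<^sub>m (d \<cdot>\<^sub>m A) = (c * d) \<cdot>\<^sub>m (A :: 'a :: semigroup_mult mat)"
  by (intro eq_matI) (auto simp: mult.assoc)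

lemma smult_one_mat [simp]: "(1 :: 'a :: monoid_mult) \<cdot>\<^sub>m A = A"
  by (intro eq_matI) auto

lemma pauli_matrices_mem [simp]:
  "1\<^sub>m 2 \<in> pauli_matrices" "pauli_X \<in> pauli_matrices" "pauli_Y \<in> pauli_matrices" "pauli_Z \<in> pauli_matrices"
  by (auto simp: pauli_matrices_def)

lemma fourth_roots_mem [simp]:
  "1 \<in> fourth_roots" "-1 \<in> fourth_roots" "\<i> \<in> fourth_roots" "-\<i> \<in> fourth_roots"
  by (auto simp: fourth_roots_def)

text \<open>With four matrices, each of the next three facts is a check of the multiplication table.\<close>
lemma pauli_matrices_cases:
  assumes "a \<in> pauli_matrices"
  obtains "a = 1\<^sub>m 2" | "a = pauli_X" | "a = pauli_Y" | "a = pauli_Z"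
  using assms by (auto simp: pauli_matrices_def)

lemma pauli_matrices_mult:
  assumes "a \<in> pauli_matrices" "b \<in> pauli_matrices"
  shows "\<exists>c\<in>fourth_roots. \<exists>d\<in>pauli_matrices. a * b = c \<cdot>\<^sub>m d"
proof -
  have phased: "\<exists>c'\<in>fourth_roots. \<exists>d'\<in>pauli_matrices. c \<cdot>\<^sub>m d = c' \<cdot>\<^sub>m d'"
    if "c \<in> fourth_roots" "d \<in> pauli_matrices" for c d
    using that by blast
  have unphased: "\<exists>c'\<in>fourth_roots. \<exists>d'\<in>pauli_matrices. d = c' \<cdot>\<^sub>m d'"
    if "d \<in> pauli_matrices" for d
    using phased[of 1 d] that by simp
  show ?thesis
    by (rule pauli_matrices_cases[OF assms(1)]; rule pauli_matrices_cases[OF assms(2)])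
      (simp_all only: pauli_mult left_mult_one_mat[OF pauli_carrier(1)] left_mult_one_mat[OF pauli_carrier(2)]
        left_mult_one_mat[OF pauli_carrier(3)] right_mult_one_mat[OF pauli_carrier(1)]
        right_mult_one_mat[OF pauli_carrier(2)] right_mult_one_mat[OF pauli_carrier(3)]
        left_mult_one_mat[OF one_carrier_mat] phased unphased pauli_matrices_mem fourth_roots_mem)
qed

lemma pauli_matrices_commute_sign:
  assumes "a \<in> pauli_matrices" "b \<in> pauli_matrices"
  shows "\<exists>s\<in>{1, -1}. a * b = s \<cdot>\<^sub>m (b * a)"
  by (rule pauli_matrices_cases[OF assms(1)]; rule pauli_matrices_cases[OF assms(2)])
    (simp_all add: pauli_mult smult_smult_mat)

lemma pauli_matrices_anticommuting:
  assumes "a \<in> pauli_matrices" "a \<noteq> 1\<^sub>m 2"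
  shows "\<exists>b\<in>pauli_matrices. a * b = (-1) \<cdot>\<^sub>m (b * a)"
  by (rule pauli_matrices_cases[OF assms(1)])
    (use assms(2) in \<open>auto simp: pauli_matrices_def pauli_mult smult_smult_mat\<close>)

section \<open>Pauli strings\<close>

lemma pauli_strings_0: "pauli_strings 0 = {1\<^sub>m 1}"
  by (auto simp: pauli_strings_def kronecker_list_def)

lemma pauli_strings_Suc:
  "pauli_strings (Suc n) = {kronecker a t | a t. a \<in> pauli_matrices \<and> t \<in> pauli_strings n}"
proof (intro equalityI subsetI)
  fix s assume "s \<in> pauli_strings (Suc n)"
  then obtain as where as: "s = kronecker_list as" "length as = Suc n" "set as \<subseteq> pauli_matrices"
    unfolding pauli_strings_def pauli_matrices_def by blast
  then obtain a bs where "as = a # bs" by (cases as) auto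
  then have "s = kronecker a (kronecker_list bs)" "a \<in> pauli_matrices" "kronecker_list bs \<in> pauli_strings n"
    using as unfolding pauli_strings_def pauli_matrices_def by (auto simp: kronecker_list_def)
  then show "s \<in> {kronecker a t | a t. a \<in> pauli_matrices \<and> t \<in> pauli_strings n}" by blast
next
  fix s assume "s \<in> {kronecker a t | a t. a \<in> pauli_matrices \<and> t \<in> pauli_strings n}"
  then obtain a bs where "s = kronecker a (kronecker_list bs)" "a \<in> pauli_matrices" "length bs = n"
    "set bs \<subseteq> pauli_matrices"
    unfolding pauli_strings_def pauli_matrices_def by blast
  then have "s = kronecker_list (a # bs)" "length (a # bs) = Suc n" "set (a # bs) \<subseteq> pauli_matrices"
    by (auto simp: kronecker_list_def)
  then show "s \<in> pauli_strings (Suc n)"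
    unfolding pauli_strings_def pauli_matrices_def by blast
qed

lemma kronecker_string_cases:
  assumes "s \<in> pauli_strings (Suc n)"
  obtains a t where "s = kronecker a t" "a \<in> pauli_matrices" "t \<in> pauli_strings n"
  using assms unfolding pauli_strings_Suc by blast

lemma kronecker_string:
  "a \<in> pauli_matrices \<Longrightarrow> t \<in> pauli_strings n \<Longrightarrow> kronecker a t \<in> pauli_strings (Suc n)"
  unfolding pauli_strings_Suc by blast

lemma pauli_strings_carrier: "s \<in> pauli_strings n \<Longrightarrow> s \<in> carrier_mat (2 ^ n) (2 ^ n)"
proof (induction n arbitrary: s)
  case (Suc n)
  then show ?case
    using kronecker_carrier[OF pauli_matrices_carrier] by (metis kronecker_string_cases power_Suc)
qed (auto simp: pauli_strings_0)

lemma pauli_strings_mult_kronecker: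
  assumes "a \<in> pauli_matrices" "b \<in> pauli_matrices" "s \<in> pauli_strings n" "t \<in> pauli_strings n"
  shows "kronecker a s * kronecker b t = kronecker (a * b) (s * t)"
  by (rule kronecker_mult[OF pauli_matrices_carrier pauli_matrices_carrier
        pauli_strings_carrier pauli_strings_carrier]) fact+

lemma finite_pauli_strings: "finite (pauli_strings n)"
proof (induction n)
  case (Suc n)
  have "pauli_strings (Suc n) = (\<lambda>(a, t). kronecker a t) ` (pauli_matrices \<times> pauli_strings n)"
    unfolding pauli_strings_Suc by auto
  then show ?case using Suc by (simp add: pauli_matrices_def)
qed (simp add: pauli_strings_0)

lemma one_pauli_string [simp]: "1\<^sub>m (2 ^ n) \<in> pauli_strings n"
proof (induction n)
  case (Suc n)
  then show ?case using kronecker_string[of "1\<^sub>m 2" "1\<^sub>m (2 ^ n)" n] by (simp add: kronecker_one)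
qed (simp add: pauli_strings_0)

lemma pauli_strings_hermitian: "s \<in> pauli_strings n \<Longrightarrow> mat_adjoint s = s"
proof (induction n arbitrary: s)
  case (Suc n)
  then show ?case
    by (metis kronecker_string_cases kronecker_adjoint pauli_matrices_hermitian)
qed (simp add: pauli_strings_0)

lemma pauli_strings_square: "s \<in> pauli_strings n \<Longrightarrow> s * s = 1\<^sub>m (2 ^ n)"
proof (induction n arbitrary: s)
  case (Suc n)
  obtain a t where "s = kronecker a t" "a \<in> pauli_matrices" "t \<in> pauli_strings n"
    using Suc.prems by (rule kronecker_string_cases)
  then show ?case using Suc.IH
    by (simp add: pauli_strings_mult_kronecker pauli_matrices_square kronecker_one)
qed (simp add: pauli_strings_0)

lemma pauli_strings_mult:
  assumes "s \<in> pauli_strings n" "t \<in> pauli_strings n"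
  shows "\<exists>c\<in>fourth_roots. \<exists>r\<in>pauli_strings n. s * t = c \<cdot>\<^sub>m r"
  using assms
proof (induction n arbitrary: s t)
  case (Suc n)
  obtain a s' where s: "s = kronecker a s'" "a \<in> pauli_matrices" "s' \<in> pauli_strings n"
    using Suc.prems(1) by (rule kronecker_string_cases)
  obtain b t' where t: "t = kronecker b t'" "b \<in> pauli_matrices" "t' \<in> pauli_strings n"
    using Suc.prems(2) by (rule kronecker_string_cases)
  obtain c d where cd: "c \<in> fourth_roots" "d \<in> pauli_matrices" "a * b = c \<cdot>\<^sub>m d"
    using pauli_matrices_mult s t by blast
  obtain c' d' where cd': "c' \<in> fourth_roots" "d' \<in> pauli_strings n" "s' * t' = c' \<cdot>\<^sub>m d'"
    using Suc.IH s t by blast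
  have "s * t = (c * c') \<cdot>\<^sub>m kronecker d d'"
    using s t cd cd' by (simp add: pauli_strings_mult_kronecker kronecker_smult)
  then show ?case using fourth_roots_mult kronecker_string cd cd' by blast
qed (auto simp: pauli_strings_0 intro!: bexI[of _ 1])

lemma pauli_strings_commute_sign:
  assumes "s \<in> pauli_strings n" "t \<in> pauli_strings n"
  shows "\<exists>e\<in>{1, -1}. s * t = e \<cdot>\<^sub>m (t * s)"
  using assms
proof (induction n arbitrary: s t)
  case (Suc n)
  obtain a s' where s: "s = kronecker a s'" "a \<in> pauli_matrices" "s' \<in> pauli_strings n"
    using Suc.prems(1) by (rule kronecker_string_cases)
  obtain b t' where t: "t = kronecker b t'" "b \<in> pauli_matrices" "t' \<in> pauli_strings n"
    using Suc.prems(2) by (rule kronecker_string_cases)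
  obtain e where e: "e \<in> {1, -1}" "a * b = e \<cdot>\<^sub>m (b * a)"
    using pauli_matrices_commute_sign s t by blast
  obtain e' where e': "e' \<in> {1, -1}" "s' * t' = e' \<cdot>\<^sub>m (t' * s')"
    using Suc.IH s t by blast
  have "s * t = (e * e') \<cdot>\<^sub>m (t * s)"
    using s t e(2) e'(2) by (simp add: pauli_strings_mult_kronecker kronecker_smult)
  moreover have "e * e' \<in> {1, -1}" using e(1) e'(1) by auto
  ultimately show ?case by blast
qed (simp add: pauli_strings_0)

text \<open>A string different from the identity has a nontrivial factor; a Pauli matrix anticommuting
  with that factor, placed at the same position among identities, anticommutes with the string.
  This is the nondegeneracy of the commutation form.\<close>
lemma pauli_strings_anticommuting:
  assumes "s \<in> pauli_strings n" "s \<noteq> 1\<^sub>m (2 ^ n)"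
  shows "\<exists>t\<in>pauli_strings n. s * t = (-1) \<cdot>\<^sub>m (t * s)"
  using assms
proof (induction n arbitrary: s)
  case (Suc n)
  obtain a s' where s: "s = kronecker a s'" "a \<in> pauli_matrices" "s' \<in> pauli_strings n"
    using Suc.prems(1) by (rule kronecker_string_cases)
  have smult: "kronecker ((-1) \<cdot>\<^sub>m x) y = (-1) \<cdot>\<^sub>m kronecker x y" "kronecker x ((-1) \<cdot>\<^sub>m y) = (-1) \<cdot>\<^sub>m kronecker x y"
    for x y :: "complex mat"
    using kronecker_smult[of "-1" x 1 y] kronecker_smult[of 1 x "-1" y] by simp_all
  show ?case
  proof (cases "a = 1\<^sub>m 2")
    case True
    then have "s' \<noteq> 1\<^sub>m (2 ^ n)" using Suc.prems(2) s by (auto simp: kronecker_one)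
    then obtain t where t: "t \<in> pauli_strings n" "s' * t = (-1) \<cdot>\<^sub>m (t * s')" using Suc.IH s by blast
    have "s * kronecker (1\<^sub>m 2) t = (-1) \<cdot>\<^sub>m (kronecker (1\<^sub>m 2) t * s)"
      using s t(1) True by (simp add: pauli_strings_mult_kronecker t(2) smult)
    then show ?thesis using kronecker_string[OF pauli_matrices_mem(1) t(1)] by blast
  next
    case False
    then obtain b where b: "b \<in> pauli_matrices" "a * b = (-1) \<cdot>\<^sub>m (b * a)"
      using pauli_matrices_anticommuting s by blast
    have "s' * 1\<^sub>m (2 ^ n) = 1\<^sub>m (2 ^ n) * s'" using pauli_strings_carrier[OF s(3)] by simp
    then have "s * kronecker b (1\<^sub>m (2 ^ n)) = (-1) \<cdot>\<^sub>m (kronecker b (1\<^sub>m (2 ^ n)) * s)"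
      using pauli_strings_mult_kronecker[OF s(2) b(1) s(3) one_pauli_string]
        pauli_strings_mult_kronecker[OF b(1) s(2) one_pauli_string s(3)]
      by (simp add: s(1) b(2) smult)
    then show ?thesis using kronecker_string[OF b(1) one_pauli_string] by blast
  qed
qed (simp add: pauli_strings_0)

section \<open>The projective commutant of the Pauli strings\<close>

text \<open>The Pauli strings span all matrices, expressed dually: a linear functional with coefficients
  \<open>F\<close> that vanishes on all strings is zero. Splitting both indices into the leading bit and the
  rest turns the functional on \<open>kronecker a t\<close> into a functional on the single-qubit matrix
  \<open>a\<close>, with coefficients \<open>M t p q\<close> that are functionals of \<open>t\<close>.\<close>
lemma pauli_strings_separate:
  fixes F :: "nat \<Rightarrow> nat \<Rightarrow> complex"
  assumes "\<And>s. s \<in> pauli_strings n \<Longrightarrow> (\<Sum>i<2 ^ n. \<Sum>j<2 ^ n. s $$ (i, j) * F i j) = 0"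
    and "i < 2 ^ n" "j < 2 ^ n"
  shows "F i j = 0"
  using assms
proof (induction n arbitrary: F i j)
  case 0
  then show ?case by (simp add: pauli_strings_0)
next
  case (Suc n)
  define N :: nat where "N = 2 ^ n"
  define M where "M t p q = (\<Sum>k<N. \<Sum>l<N. t $$ (k, l) * F (p * N + k) (q * N + l))"
    for t :: "complex mat" and p q
  have expand: "(\<Sum>p<2. \<Sum>q<2. a $$ (p, q) * M t p q) = 0"
    if a: "a \<in> pauli_matrices" and t: "t \<in> pauli_strings n" for a t
  proof -
    have dims: "dim_row a = 2" "dim_col a = 2" "dim_row t = N" "dim_col t = N"
      using pauli_matrices_carrier[OF a] pauli_strings_carrier[OF t] by (auto simp: N_def)
    have "0 = (\<Sum>i<2 * N. \<Sum>j<2 * N. kronecker a t $$ (i, j) * F i j)"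
      using Suc.prems(1)[OF kronecker_string[OF a t]] by (simp add: N_def)
    also have "\<dots> = (\<Sum>i<2 * N. \<Sum>j<2 * N. a $$ (i div N, j div N) * t $$ (i mod N, j mod N) *
        F (i div N * N + i mod N) (j div N * N + j mod N))"
      using dims by (intro sum.cong) (auto simp: kronecker_index)
    also have "\<dots> = (\<Sum>i<2 * N. \<Sum>q<2. \<Sum>l<N. a $$ (i div N, q) * t $$ (i mod N, l) *
        F (i div N * N + i mod N) (q * N + l))"
      by (intro sum.cong refl sum_div_mod[where f = "\<lambda>q l. a $$ (i div N, q) * t $$ (i mod N, l) *
            F (i div N * N + i mod N) (q * N + l)" for i])
    also have "\<dots> = (\<Sum>p<2. \<Sum>k<N. \<Sum>q<2. \<Sum>l<N. a $$ (p, q) * t $$ (k, l) * F (p * N + k) (q * N + l))"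
      by (rule sum_div_mod[where f = "\<lambda>p k. \<Sum>q<2. \<Sum>l<N. a $$ (p, q) * t $$ (k, l) * F (p * N + k) (q * N + l)"])
    also have "\<dots> = (\<Sum>p<2. \<Sum>q<2. \<Sum>k<N. \<Sum>l<N. a $$ (p, q) * t $$ (k, l) * F (p * N + k) (q * N + l))"
      by (rule sum.cong[OF refl], rule sum.swap)
    also have "\<dots> = (\<Sum>p<2. \<Sum>q<2. a $$ (p, q) * M t p q)"
      by (simp add: M_def sum_distrib_left mult.assoc)
    finally show ?thesis by simp
  qed
  have M: "M t p q = 0" if t: "t \<in> pauli_strings n" and pq: "p < 2" "q < 2" for t p q
  proof -
    have "M t 0 0 + M t 1 1 = 0" "M t 0 1 + M t 1 0 = 0" "M t 0 0 - M t 1 1 = 0"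
      "- \<i> * M t 0 1 + \<i> * M t 1 0 = 0"
      using expand[OF pauli_matrices_mem(1) t] expand[OF pauli_matrices_mem(2) t]
        expand[OF pauli_matrices_mem(3) t] expand[OF pauli_matrices_mem(4) t]
      by (simp_all add: numeral_2_eq_2)
    then have "M t 0 0 = 0" "M t 1 1 = 0" "M t 0 1 = 0" "M t 1 0 = 0"
      by (auto simp: algebra_simps add_eq_0_iff)
    then show ?thesis using pq by (auto simp: less_2_cases_iff)
  qed
  have ij: "i < 2 * N" "j < 2 * N" using Suc.prems by (auto simp: N_def)
  note b = div_mod_bounds[OF ij(1)] div_mod_bounds[OF ij(2)]
  have "F (i div N * N + i mod N) (j div N * N + j mod N) = 0"
    by (rule Suc.IH[where F = "\<lambda>k l. F (i div N * N + k) (j div N * N + l)"])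
      (use M[OF _ b(1) b(3)] b in \<open>auto simp: M_def N_def\<close>)
  then show ?case by simp
qed

definition mat_trace :: "complex mat \<Rightarrow> complex" where
  "mat_trace A = (\<Sum>i<dim_row A. A $$ (i, i))"

lemma mat_trace_mult:
  assumes "A \<in> carrier_mat m n" "B \<in> carrier_mat n m"
  shows "mat_trace (A * B) = (\<Sum>i<m. \<Sum>j<n. A $$ (i, j) * B $$ (j, i))"
  using assms by (simp add: mat_trace_def scalar_prod_def atLeast0LessThan)

lemma mat_trace_comm:
  assumes "A \<in> carrier_mat m n" "B \<in> carrier_mat n m"
  shows "mat_trace (A * B) = mat_trace (B * A)"
  unfolding mat_trace_mult[OF assms] mat_trace_mult[OF assms(2,1)]
  by (subst sum.swap) (simp add: mult.commute)

lemma mat_trace_smult: "mat_trace (c \<cdot>\<^sub>m A) = c * mat_trace A" if "A \<in> carrier_mat m m"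
  using that by (simp add: mat_trace_def sum_distrib_left)

lemma mat_trace_minus:
  assumes "A \<in> carrier_mat m m" "B \<in> carrier_mat m m"
  shows "mat_trace (A - B) = mat_trace A - mat_trace B"
  using assms by (simp add: mat_trace_def sum_subtractf)

lemma mat_trace_one: "mat_trace (1\<^sub>m m) = of_nat m"
  by (simp add: mat_trace_def)

lemma pauli_strings_trace_separate:
  assumes A: "A \<in> carrier_mat (2 ^ n) (2 ^ n)"
    and zero: "\<And>s. s \<in> pauli_strings n \<Longrightarrow> mat_trace (s * A) = 0"
  shows "A = 0\<^sub>m (2 ^ n) (2 ^ n)"
proof (rule eq_matI)
  fix i j assume "i < dim_row (0\<^sub>m (2 ^ n) (2 ^ n) :: complex mat)" "j < dim_col (0\<^sub>m (2 ^ n) (2 ^ n) :: complex mat)"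
  then have ij: "i < 2 ^ n" "j < 2 ^ n" by auto
  have "A $$ (i, j) = 0"
    by (rule pauli_strings_separate[where F = "\<lambda>k l. A $$ (l, k)", OF _ ij(2,1)])
      (use zero in \<open>simp add: mat_trace_mult[OF pauli_strings_carrier A, symmetric]\<close>)
  then show "A $$ (i, j) = 0\<^sub>m (2 ^ n) (2 ^ n) $$ (i, j)" using ij by simp
qed (use A in auto)

text \<open>Conjugating by a string that anticommutes with \<open>r\<close> preserves the trace of \<open>r * B\<close> and also
  negates it.\<close>
lemma commutant_trace_zero:
  assumes B: "B \<in> carrier_mat (2 ^ n) (2 ^ n)"
    and comm: "\<And>s. s \<in> pauli_strings n \<Longrightarrow> B * s = s * B"
    and r: "r \<in> pauli_strings n" "r \<noteq> 1\<^sub>m (2 ^ n)"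
  shows "mat_trace (r * B) = 0"
proof -
  let ?N = "2 ^ n :: nat"
  note sq = assoc_mult_mat[of _ ?N ?N _ ?N _ ?N] mult_carrier_mat[of _ ?N ?N _ ?N]
    mult_smult_assoc_mat[of _ ?N ?N _ ?N] mult_smult_distrib[of _ ?N ?N _ ?N]
  obtain s where s: "s \<in> pauli_strings n" "r * s = (-1) \<cdot>\<^sub>m (s * r)"
    using pauli_strings_anticommuting[OF r] by blast
  have car: "r \<in> carrier_mat ?N ?N" "s \<in> carrier_mat ?N ?N"
    using r s pauli_strings_carrier by auto
  have ss: "s * (s * X) = X" if "X \<in> carrier_mat ?N ?N" for X
    using that car pauli_strings_square[OF s(1)] by (simp flip: sq(1))
  have "mat_trace (r * B) = mat_trace (B * r)"
    using mat_trace_comm B car by blast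
  also have "B * r = (B * s) * (s * r)"
    using B car by (simp add: sq ss)
  also have "mat_trace \<dots> = mat_trace ((s * r) * (B * s))"
    using B car by (intro mat_trace_comm[of _ ?N ?N]) (auto simp: sq)
  also have "(s * r) * (B * s) = s * (r * s) * B"
    using B car comm[OF s(1)] by (simp add: sq)
  also have "\<dots> = (-1) \<cdot>\<^sub>m (r * B)"
    using B car by (simp add: s(2) sq ss)
  also have "mat_trace \<dots> = - mat_trace (r * B)"
    using B car by (subst mat_trace_smult[of _ ?N]) (auto simp: sq)
  finally show ?thesis by simp
qed

text \<open>Schur's lemma for the Pauli strings: after subtracting the scalar matrix with the same trace,
  \<open>B\<close> has vanishing trace against every string, hence is zero.\<close>
lemma pauli_commutant_scalar:
  assumes B: "B \<in> carrier_mat (2 ^ n) (2 ^ n)"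
    and comm: "\<And>s. s \<in> pauli_strings n \<Longrightarrow> B * s = s * B"
  shows "\<exists>c. B = c \<cdot>\<^sub>m 1\<^sub>m (2 ^ n)"
proof -
  let ?N = "2 ^ n :: nat" and ?I = "1\<^sub>m (2 ^ n) :: complex mat"
  define c where "c = mat_trace B / of_nat (2 ^ n)"
  have cI: "c \<cdot>\<^sub>m ?I \<in> carrier_mat ?N ?N" by simp
  have "B - c \<cdot>\<^sub>m ?I = 0\<^sub>m ?N ?N"
  proof (rule pauli_strings_trace_separate)
    show "B - c \<cdot>\<^sub>m ?I \<in> carrier_mat ?N ?N" by (rule minus_carrier_mat[OF cI])
    fix s assume s: "s \<in> pauli_strings n"
    note sc = pauli_strings_carrier[OF s]
    have "s * (B - c \<cdot>\<^sub>m ?I) = s * B - c \<cdot>\<^sub>m (s * ?I)"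
      using mult_minus_distrib_mat[OF sc B cI] mult_smult_distrib[OF sc, of ?I ?N c] by simp
    then have tr: "mat_trace (s * (B - c \<cdot>\<^sub>m ?I)) = mat_trace (s * B) - c * mat_trace (s * ?I)"
      using sc B mat_trace_minus[of "s * B" ?N "c \<cdot>\<^sub>m (s * ?I)"] mat_trace_smult[of "s * ?I" ?N c] by simp
    show "mat_trace (s * (B - c \<cdot>\<^sub>m ?I)) = 0"
    proof (cases "s = ?I")
      case True
      then show ?thesis using tr B by (simp add: mat_trace_one c_def)
    next
      case False
      have "mat_trace (s * B) = 0" using commutant_trace_zero[OF B comm s False] .
      moreover have "mat_trace (s * ?I) = 0"
        by (rule commutant_trace_zero[OF one_carrier_mat _ s False])
          (use pauli_strings_carrier in \<open>metis left_mult_one_mat right_mult_one_mat\<close>)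
      ultimately show ?thesis using tr by simp
    qed
  qed
  then have "B = c \<cdot>\<^sub>m ?I"
    using B by (auto simp: mat_eq_iff)
  then show ?thesis ..
qed

text \<open>Some string \<open>r\<close> has nonzero trace against \<open>A\<close>; then \<open>B = r * A\<close> also commutes with each
  string up to a scalar, and since conjugation preserves the nonzero trace of \<open>B\<close>, all these
  scalars are one. So \<open>B\<close> is a scalar matrix and \<open>A\<close> a multiple of \<open>r\<close>. This takes the place of
  the self-duality of the symplectic space, by which the characters of the Pauli group come
  from Pauli strings.\<close>
lemma pauli_projective_commutant:
  assumes A: "A \<in> carrier_mat (2 ^ n) (2 ^ n)" "A \<noteq> 0\<^sub>m (2 ^ n) (2 ^ n)"
    and comm: "\<And>s. s \<in> pauli_strings n \<Longrightarrow> \<exists>c. A * s = c \<cdot>\<^sub>m (s * A)"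
  shows "\<exists>c. \<exists>r\<in>pauli_strings n. A = c \<cdot>\<^sub>m r"
proof -
  let ?N = "2 ^ n :: nat"
  note sq = assoc_mult_mat[of _ ?N ?N _ ?N _ ?N] mult_carrier_mat[of _ ?N ?N _ ?N]
    mult_smult_assoc_mat[of _ ?N ?N _ ?N] mult_smult_distrib[of _ ?N ?N _ ?N]
  note car = A(1) pauli_strings_carrier
  obtain r where r: "r \<in> pauli_strings n" "mat_trace (r * A) \<noteq> 0"
    using pauli_strings_trace_separate[OF A(1)] A(2) by blast
  define B where "B = r * A"
  have B: "B \<in> carrier_mat ?N ?N" "mat_trace B \<noteq> 0" using r car by (auto simp: B_def sq)
  have "B * s = s * B" if s: "s \<in> pauli_strings n" for s
  proof -
    obtain c where c: "A * s = c \<cdot>\<^sub>m (s * A)" using comm s by blast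
    obtain e where e: "r * s = e \<cdot>\<^sub>m (s * r)" using pauli_strings_commute_sign r s by blast
    have "B * s = r * (A * s)" using r s car by (simp add: B_def sq)
    also have "\<dots> = c \<cdot>\<^sub>m ((r * s) * A)" using r s car by (simp add: c sq)
    also have "\<dots> = (c * e) \<cdot>\<^sub>m (s * B)" using r s car by (simp add: e B_def sq smult_smult_mat)
    finally have Bs: "B * s = (c * e) \<cdot>\<^sub>m (s * B)" .
    have ss: "s * (s * B) = B"
      using pauli_strings_square[OF s] B car(2)[OF s] by (simp flip: sq(1))
    have "mat_trace B = mat_trace (s * (s * B))" by (simp add: ss)
    also have "\<dots> = mat_trace (s * B * s)"
      using B car(2)[OF s] by (intro mat_trace_comm[of _ ?N ?N]) (auto simp: sq)
    also have "s * B * s = (c * e) \<cdot>\<^sub>m B"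
      using B car(2)[OF s] by (simp add: sq Bs ss)
    also have "mat_trace \<dots> = (c * e) * mat_trace B" using mat_trace_smult[OF B(1)] .
    finally have "c * e = 1" using B(2) by simp
    then show ?thesis using Bs by simp
  qed
  then obtain c where "B = c \<cdot>\<^sub>m 1\<^sub>m ?N" using pauli_commutant_scalar[OF B(1)] by blast
  then have "r * B = c \<cdot>\<^sub>m r" using car(2)[OF r(1)] by (simp add: sq)
  moreover have "r * B = A"
    using pauli_strings_square[OF r(1)] car(2)[OF r(1)] A(1) by (simp add: B_def flip: sq(1))
  ultimately show ?thesis using r by auto
qed

section \<open>The group generated by the Pauli strings\<close>

lemma pauli_string_unitary: "s \<in> pauli_strings n \<Longrightarrow> s \<in> carrier (unitary_group (2 ^ n))"
  using pauli_strings_carrier pauli_strings_hermitian pauli_strings_square by auto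

lemma smult_mult_smult_mat:
  fixes A B :: "complex mat"
  assumes "A \<in> carrier_mat N N" "B \<in> carrier_mat N N"
  shows "(c \<cdot>\<^sub>m A) * (d \<cdot>\<^sub>m B) = (c * d) \<cdot>\<^sub>m (A * B)"
  using assms by (simp add: mult_smult_assoc_mat[of _ N N _ N] mult_smult_distrib[of _ N N _ N] smult_smult_mat mult.commute)

text \<open>The identity \<open>X Y Z = i\<close>, applied to the first qubit. The phase \<open>i\<close> is needed in the group
  because a Pauli rotation by \<open>s\<close> turns a string \<open>y\<close> anticommuting with \<open>s\<close> into \<open>i s y\<close>.\<close>
lemma imaginary_unit_generated:
  assumes "n \<ge> 1"
  shows "\<i> \<cdot>\<^sub>m 1\<^sub>m (2 ^ n) \<in> pauli_unitaries n"
proof -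
  obtain m where n: "n = Suc m" using assms by (cases n) auto
  let ?k = "\<lambda>a. kronecker a (1\<^sub>m (2 ^ m))"
  have one: "(1\<^sub>m (2 ^ m) :: complex mat) * 1\<^sub>m (2 ^ m) = 1\<^sub>m (2 ^ m)" by simp
  have XY: "pauli_X * pauli_Y = \<i> \<cdot>\<^sub>m pauli_Z" by (rule pauli_mult)
  have mem: "?k a \<in> pauli_unitaries n" if "a \<in> pauli_matrices" for a
    unfolding pauli_unitaries_def n by (rule generate.incl, rule kronecker_string[OF that one_pauli_string])
  have "?k pauli_X * ?k pauli_Y = \<i> \<cdot>\<^sub>m ?k pauli_Z"
    using pauli_strings_mult_kronecker[OF pauli_matrices_mem(2,3) one_pauli_string one_pauli_string, of m]
      kronecker_smult[of \<i> pauli_Z 1 "1\<^sub>m (2 ^ m)"] by (simp add: XY one)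
  then have "?k pauli_X * ?k pauli_Y * ?k pauli_Z = \<i> \<cdot>\<^sub>m (?k pauli_Z * ?k pauli_Z)"
    by (simp add: mult_smult_assoc_mat[of _ "2 * 2 ^ m" "2 * 2 ^ m" _ "2 * 2 ^ m"])
  also have "?k pauli_Z * ?k pauli_Z = 1\<^sub>m (2 ^ n)"
    using pauli_strings_square[OF kronecker_string[OF pauli_matrices_mem(4) one_pauli_string], of m]
    by (simp add: n)
  finally show ?thesis
    using mem[of pauli_X] mem[of pauli_Y] mem[of pauli_Z]
      generate.eng[where G = "unitary_group (2 ^ n)" and H = "pauli_strings n"]
    unfolding pauli_unitaries_def by (metis pauli_matrices_mem(2-4) unitary_group_simps(2))
qed

lemma pauli_unitaries_eq:
  assumes "n \<ge> 1"
  shows "pauli_unitaries n = {c \<cdot>\<^sub>m s | c s. c \<in> fourth_roots \<and> s \<in> pauli_strings n}"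
proof (intro equalityI subsetI)
  fix x assume "x \<in> pauli_unitaries n"
  then show "x \<in> {c \<cdot>\<^sub>m s | c s. c \<in> fourth_roots \<and> s \<in> pauli_strings n}"
    unfolding pauli_unitaries_def
  proof induction
    case one
    have "(1\<^sub>m (2 ^ n) :: complex mat) = 1 \<cdot>\<^sub>m 1\<^sub>m (2 ^ n)" by simp
    then show ?case using one_pauli_string fourth_roots_mem(1) by (metis (mono_tags, lifting) mem_Collect_eq unitary_group_simps(3))
  next
    case (incl h)
    have "h = 1 \<cdot>\<^sub>m h" by simp
    then show ?case using incl fourth_roots_mem(1) by blast
  next
    case (inv h)
    then have "inv\<^bsub>unitary_group (2 ^ n)\<^esub> h = 1 \<cdot>\<^sub>m h"
      by (simp add: unitary_group_inv[OF pauli_string_unitary] pauli_strings_hermitian)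
    then show ?case using inv fourth_roots_mem(1) by blast
  next
    case (eng h1 h2)
    then obtain c s d t where h: "h1 = c \<cdot>\<^sub>m s" "h2 = d \<cdot>\<^sub>m t" "c \<in> fourth_roots" "d \<in> fourth_roots"
      "s \<in> pauli_strings n" "t \<in> pauli_strings n" by blast
    obtain e r where r: "e \<in> fourth_roots" "r \<in> pauli_strings n" "s * t = e \<cdot>\<^sub>m r"
      using pauli_strings_mult h by blast
    have "h1 * h2 = (c * d * e) \<cdot>\<^sub>m r"
      using h r by (simp add: smult_mult_smult_mat[OF pauli_strings_carrier pauli_strings_carrier] smult_smult_mat)
    then show ?case using h r fourth_roots_mult by auto blast
  qed
next
  fix x assume "x \<in> {c \<cdot>\<^sub>m s | c s. c \<in> fourth_roots \<and> s \<in> pauli_strings n}"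
  then obtain c s where x: "x = c \<cdot>\<^sub>m s" "c \<in> fourth_roots" "s \<in> pauli_strings n" by blast
  have i: "\<i> \<cdot>\<^sub>m y \<in> pauli_unitaries n" if "y \<in> pauli_unitaries n" "y \<in> carrier_mat (2 ^ n) (2 ^ n)" for y
  proof -
    have "(\<i> \<cdot>\<^sub>m 1\<^sub>m (2 ^ n)) * y = \<i> \<cdot>\<^sub>m y"
      using that by (simp add: mult_smult_assoc_mat[of _ "2 ^ n" "2 ^ n" _ "2 ^ n"])
    then show ?thesis
      using generate.eng[OF imaginary_unit_generated[OF assms, unfolded pauli_unitaries_def] that(1)[unfolded pauli_unitaries_def]]
      by (simp add: pauli_unitaries_def)
  qed
  note sc = pauli_strings_carrier[OF x(3)]
  have s: "s \<in> pauli_unitaries n" unfolding pauli_unitaries_def using x(3) by (rule generate.incl)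
  have 1: "\<i> \<cdot>\<^sub>m s \<in> pauli_unitaries n" using i s sc by blast
  have 2: "(-1) \<cdot>\<^sub>m s \<in> pauli_unitaries n" using i[OF 1] sc by (simp add: smult_smult_mat)
  have 3: "(-\<i>) \<cdot>\<^sub>m s \<in> pauli_unitaries n" using i[OF 2] sc by (simp add: smult_smult_mat)
  show "x \<in> pauli_unitaries n"
    using x s 1 2 3 by (auto simp: fourth_roots_def)
qed

lemma pauli_unitary_cases:
  assumes "n \<ge> 1" "x \<in> pauli_unitaries n"
  obtains c s where "x = c \<cdot>\<^sub>m s" "c \<in> fourth_roots" "s \<in> pauli_strings n"
  using assms pauli_unitaries_eq by blast

lemma finite_pauli_unitaries: "n \<ge> 1 \<Longrightarrow> finite (pauli_unitaries n)"
proof -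
  assume "n \<ge> 1"
  then have "pauli_unitaries n = (\<lambda>(c, s). c \<cdot>\<^sub>m s) ` (fourth_roots \<times> pauli_strings n)"
    unfolding pauli_unitaries_eq[OF \<open>n \<ge> 1\<close>] by auto
  then show ?thesis using finite_pauli_strings by (simp add: fourth_roots_def)
qed

lemma pauli_strings_subset_unitaries: "pauli_strings n \<subseteq> pauli_unitaries n"
  unfolding pauli_unitaries_def by (auto intro: generate.incl)

lemma pauli_unitaries_subgroup: "subgroup (pauli_unitaries n) (unitary_group (2 ^ n))"
  unfolding pauli_unitaries_def
  by (rule group.generate_is_subgroup[OF unitary_group_group]) (use pauli_string_unitary in blast)

lemma pauli_unitary_unitary: "x \<in> pauli_unitaries n \<Longrightarrow> x \<in> carrier (unitary_group (2 ^ n))"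
  using subgroup.mem_carrier[OF pauli_unitaries_subgroup] .

lemma pauli_unitary_mult: "x \<in> pauli_unitaries n \<Longrightarrow> y \<in> pauli_unitaries n \<Longrightarrow> x * y \<in> pauli_unitaries n"
  using subgroup.m_closed[OF pauli_unitaries_subgroup] by simp

lemma pauli_unitary_commute_sign:
  assumes "n \<ge> 1" "x \<in> pauli_unitaries n" "y \<in> pauli_unitaries n"
  shows "\<exists>e\<in>{1, -1}. x * y = e \<cdot>\<^sub>m (y * x)"
proof -
  obtain c s where x: "x = c \<cdot>\<^sub>m s" "s \<in> pauli_strings n" using pauli_unitary_cases assms by metis
  obtain d t where y: "y = d \<cdot>\<^sub>m t" "t \<in> pauli_strings n" using pauli_unitary_cases assms by metis
  obtain e where e: "e \<in> {1, -1}" "s * t = e \<cdot>\<^sub>m (t * s)" using pauli_strings_commute_sign x y by blast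
  have "x * y = e \<cdot>\<^sub>m (y * x)"
    using x y e(2) by (simp add: smult_mult_smult_mat[OF pauli_strings_carrier pauli_strings_carrier]
        smult_smult_mat mult_ac)
  then show ?thesis using e(1) by blast
qed

section \<open>Clifford unitaries\<close>

lemma clifford_iff:
  "A \<in> clifford_unitaries n \<longleftrightarrow> A \<in> carrier (unitary_group (2 ^ n)) \<and>
     (\<forall>x\<in>pauli_unitaries n. A * x * mat_adjoint A \<in> pauli_unitaries n)"
  unfolding clifford_unitaries_def using unitary_group_inv[of A "2 ^ n"] by auto

lemma clifford_carrier: "A \<in> clifford_unitaries n \<Longrightarrow> A \<in> carrier_mat (2 ^ n) (2 ^ n)"
  by (simp add: clifford_iff)

text \<open>A Clifford unitary is only required to map the Pauli unitaries into themselves. There are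
  finitely many of them, so it permutes them, which gives closure under inverses.\<close>
lemma clifford_subgroup:
  assumes "n \<ge> 1"
  shows "subgroup (clifford_unitaries n) (unitary_group (2 ^ n))"
proof (rule group.subgroupI[OF unitary_group_group])
  let ?N = "2 ^ n :: nat" and ?Q = "pauli_unitaries n"
  note sq = assoc_mult_mat[of _ ?N ?N _ ?N _ ?N] mult_carrier_mat[of _ ?N ?N _ ?N]
  have Q: "x \<in> carrier_mat ?N ?N" if "x \<in> ?Q" for x using pauli_unitary_unitary[OF that] by simp
  show "clifford_unitaries n \<subseteq> carrier (unitary_group ?N)" by (auto simp: clifford_iff)
  have "1\<^sub>m ?N \<in> clifford_unitaries n"
    by (simp add: clifford_iff left_mult_one_mat[OF Q] right_mult_one_mat[OF Q])
  then show "clifford_unitaries n \<noteq> {}" by blast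
  fix A assume A: "A \<in> clifford_unitaries n"
  then have AU: "A \<in> carrier (unitary_group ?N)" by (simp add: clifford_iff)
  then have Ac: "A \<in> carrier_mat ?N ?N" "mat_adjoint A \<in> carrier_mat ?N ?N"
    "mat_adjoint A * A = 1\<^sub>m ?N" "A * mat_adjoint A = 1\<^sub>m ?N" by auto
  have cancel: "mat_adjoint A * (A * x) = x" if "x \<in> carrier_mat ?N ?N" for x
    using that Ac by (simp flip: sq(1))
  let ?f = "\<lambda>x. A * x * mat_adjoint A"
  have undo: "mat_adjoint A * ?f x * A = x" if "x \<in> ?Q" for x
    using Q[OF that] Ac by (simp add: sq cancel)
  have "inj_on ?f ?Q" by (rule inj_on_inverseI[of _ "\<lambda>y. mat_adjoint A * y * A"]) (use undo in blast)
  moreover have "?f ` ?Q \<subseteq> ?Q" using A by (auto simp: clifford_iff)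
  ultimately have surj: "?f ` ?Q = ?Q"
    using endo_inj_surj[OF finite_pauli_unitaries[OF assms]] by blast
  have "mat_adjoint A \<in> clifford_unitaries n"
    unfolding clifford_iff
  proof (intro conjI ballI)
    show "mat_adjoint A \<in> carrier (unitary_group ?N)" using Ac by simp
    fix x assume "x \<in> ?Q"
    then obtain y where "y \<in> ?Q" "x = ?f y" using surj by blast
    then show "mat_adjoint A * x * mat_adjoint (mat_adjoint A) \<in> ?Q" using undo by simp
  qed
  then show "inv\<^bsub>unitary_group ?N\<^esub> A \<in> clifford_unitaries n" using unitary_group_inv[OF AU] by simp
  fix B assume B: "B \<in> clifford_unitaries n"
  then have BU: "B \<in> carrier (unitary_group ?N)" by (simp add: clifford_iff)
  then have Bc: "B \<in> carrier_mat ?N ?N" "mat_adjoint B \<in> carrier_mat ?N ?N" by auto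
  have "A * B \<in> clifford_unitaries n"
    unfolding clifford_iff
  proof (intro conjI ballI)
    show "A * B \<in> carrier (unitary_group ?N)" using AU BU by (rule unitary_mult_closed)
    fix x assume x: "x \<in> ?Q"
    have "A * B * x * mat_adjoint (A * B) = A * (B * x * mat_adjoint B) * mat_adjoint A"
      using Ac(1,2) Bc Q[OF x] by (simp add: mat_adjoint_mult[of _ ?N ?N _ ?N] sq)
    then show "A * B * x * mat_adjoint (A * B) \<in> ?Q" using A B x by (simp add: clifford_iff)
  qed
  then show "A \<otimes>\<^bsub>unitary_group ?N\<^esub> B \<in> clifford_unitaries n" by simp
qed

lemma pauli_unitary_clifford:
  assumes "x \<in> pauli_unitaries n"
  shows "x \<in> clifford_unitaries n"
  unfolding clifford_unitaries_def
  using pauli_unitary_unitary[OF assms] assms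
  by (auto intro!: subgroup.m_closed[OF pauli_unitaries_subgroup, simplified] subgroup.m_inv_closed[OF pauli_unitaries_subgroup])

section \<open>Pauli rotations\<close>

definition pauli_combination :: "complex mat \<Rightarrow> complex \<Rightarrow> complex \<Rightarrow> complex mat" where
  "pauli_combination s \<alpha> \<beta> = \<alpha> \<cdot>\<^sub>m 1\<^sub>m (dim_row s) + \<beta> \<cdot>\<^sub>m s"

lemma pauli_combination_carrier: "s \<in> carrier_mat N N \<Longrightarrow> pauli_combination s \<alpha> \<beta> \<in> carrier_mat N N"
  by (simp add: pauli_combination_def)

lemma pauli_combination_mult:
  assumes "s \<in> carrier_mat N N" "y \<in> carrier_mat N N"
  shows "pauli_combination s \<alpha> \<beta> * y = \<alpha> \<cdot>\<^sub>m y + \<beta> \<cdot>\<^sub>m (s * y)"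
    and "y * pauli_combination s \<alpha> \<beta> = \<alpha> \<cdot>\<^sub>m y + \<beta> \<cdot>\<^sub>m (y * s)"
  using assms
  by (simp_all add: pauli_combination_def add_mult_distrib_mat[of _ N N _ _ N] mult_add_distrib_mat[of _ N N _ N]
      mult_smult_assoc_mat[of _ N N _ N] mult_smult_distrib[of _ N N _ N])

lemma pauli_combination_mult_pauli_combination:
  assumes "s \<in> carrier_mat N N" "s * s = 1\<^sub>m N"
  shows "pauli_combination s \<alpha> \<beta> * pauli_combination s \<gamma> \<delta> = pauli_combination s (\<alpha> * \<gamma> + \<beta> * \<delta>) (\<alpha> * \<delta> + \<beta> * \<gamma>)"
proof -
  have "pauli_combination s \<alpha> \<beta> * pauli_combination s \<gamma> \<delta> = \<alpha> \<cdot>\<^sub>m pauli_combination s \<gamma> \<delta> + \<beta> \<cdot>\<^sub>m (\<gamma> \<cdot>\<^sub>m s + \<delta> \<cdot>\<^sub>m 1\<^sub>m N)"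
    using pauli_combination_mult[OF assms(1), of "pauli_combination s \<gamma> \<delta>"] pauli_combination_mult(2)[OF assms(1,1)] assms
    by (simp add: pauli_combination_carrier)
  also have "\<dots> = pauli_combination s (\<alpha> * \<gamma> + \<beta> * \<delta>) (\<alpha> * \<delta> + \<beta> * \<gamma>)"
    using assms(1) by (intro eq_matI) (auto simp: pauli_combination_def algebra_simps)
  finally show ?thesis .
qed

text \<open>The matrix exponential \<open>exp (i \<pi> s / 4)\<close>, for \<open>s\<close> with square one.\<close>
definition pauli_rotation :: "complex mat \<Rightarrow> complex mat" where
  "pauli_rotation s = pauli_combination s (complex_of_real (1 / sqrt 2)) (\<i> * complex_of_real (1 / sqrt 2))"

lemma inv_sqrt2_square: "complex_of_real (1 / sqrt 2) * complex_of_real (1 / sqrt 2) = 1 / 2"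
  by (simp flip: of_real_mult)

text \<open>With \<open>t = (1 + i s) / sqrt 2\<close>, a matrix \<open>y\<close> commuting with \<open>s\<close> commutes with \<open>t\<close>, while one
  anticommuting with \<open>s\<close> satisfies \<open>y t* = t y\<close>, so that conjugation yields \<open>t t y = i s y\<close>.
  Modulo phases this is the transvection with centre \<open>s\<close>.\<close>
lemma pauli_rotation:
  assumes s: "s \<in> pauli_strings n"
  defines "t \<equiv> pauli_rotation s"
  shows pauli_rotation_unitary: "t \<in> carrier (unitary_group (2 ^ n))"
    and pauli_rotation_commuting:
      "\<And>y. y \<in> carrier_mat (2 ^ n) (2 ^ n) \<Longrightarrow> s * y = y * s \<Longrightarrow> t * y * mat_adjoint t = y"
    and pauli_rotation_anticommuting:
      "\<And>y. y \<in> carrier_mat (2 ^ n) (2 ^ n) \<Longrightarrow> s * y = (-1) \<cdot>\<^sub>m (y * s) \<Longrightarrow>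
         t * y * mat_adjoint t = \<i> \<cdot>\<^sub>m (s * y)"
proof -
  let ?N = "2 ^ n :: nat" and ?r = "complex_of_real (1 / sqrt 2)"
  note sq = assoc_mult_mat[of _ ?N ?N _ ?N _ ?N] mult_carrier_mat[of _ ?N ?N _ ?N]
  have sc: "s \<in> carrier_mat ?N ?N" "s * s = 1\<^sub>m ?N" "mat_adjoint s = s"
    using s pauli_strings_carrier pauli_strings_square pauli_strings_hermitian by auto
  have r: "?r * ?r = 1 / 2" by (rule inv_sqrt2_square)
  have t: "t = pauli_combination s ?r (\<i> * ?r)" by (simp add: t_def pauli_rotation_def)
  have t': "mat_adjoint t = pauli_combination s ?r (- (\<i> * ?r))"
    using sc(1,3) by (simp add: t pauli_combination_def mat_adjoint_add[of _ ?N ?N] mat_adjoint_smult)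
  have tc: "t \<in> carrier_mat ?N ?N" "mat_adjoint t \<in> carrier_mat ?N ?N"
    using sc by (simp_all add: t pauli_combination_carrier)
  have one: "pauli_combination s 1 0 = 1\<^sub>m ?N" "pauli_combination s 0 \<i> = \<i> \<cdot>\<^sub>m s"
    using sc by (auto simp: pauli_combination_def intro!: eq_matI)
  have i: "\<i> * ?r * (\<i> * ?r) = - (1 / 2)" "?r * (\<i> * ?r) = \<i> / 2" "\<i> * ?r * ?r = \<i> / 2"
    using r by (simp_all add: algebra_simps)
  have tt': "t * mat_adjoint t = 1\<^sub>m ?N" and t't: "mat_adjoint t * t = 1\<^sub>m ?N"
    and tt: "t * t = \<i> \<cdot>\<^sub>m s"
    unfolding t' unfolding t pauli_combination_mult_pauli_combination[OF sc(1,2)] mult_minus_left mult_minus_right i r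
    using one by simp_all
  show "t \<in> carrier (unitary_group ?N)" using tc tt' t't by simp
  fix y :: "complex mat" assume y: "y \<in> carrier_mat ?N ?N"
  {
    assume c: "s * y = y * s"
    have "y * mat_adjoint t = mat_adjoint t * y"
      unfolding t' pauli_combination_mult[OF sc(1) y] c ..
    then have "t * y * mat_adjoint t = (t * mat_adjoint t) * y" using tc y by (simp add: sq)
    then show "t * y * mat_adjoint t = y" using y by (simp add: tt')
  next
    assume c: "s * y = (-1) \<cdot>\<^sub>m (y * s)"
    have "y * mat_adjoint t = t * y"
      unfolding t' unfolding t pauli_combination_mult[OF sc(1) y] c using y sc by (auto simp: smult_smult_mat)
    then have "t * y * mat_adjoint t = (t * t) * y" using tc y by (simp add: sq)
    then show "t * y * mat_adjoint t = \<i> \<cdot>\<^sub>m (s * y)"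
      using sc y by (simp add: tt mult_smult_assoc_mat[of _ ?N ?N _ ?N])
  }
qed

lemma pauli_rotation_clifford:
  assumes "n \<ge> 1" "s \<in> pauli_strings n"
  shows "pauli_rotation s \<in> clifford_unitaries n"
  unfolding clifford_iff
proof (intro conjI ballI)
  show "pauli_rotation s \<in> carrier (unitary_group (2 ^ n))" using assms(2) by (rule pauli_rotation_unitary)
  fix x assume x: "x \<in> pauli_unitaries n"
  have xc: "x \<in> carrier_mat (2 ^ n) (2 ^ n)" using pauli_unitary_unitary[OF x] by simp
  have sQ: "s \<in> pauli_unitaries n" using assms(2) pauli_strings_subset_unitaries by blast
  obtain e where e: "e \<in> {1, -1}" "s * x = e \<cdot>\<^sub>m (x * s)"
    using pauli_unitary_commute_sign[OF assms(1) sQ x] by blast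
  show "pauli_rotation s * x * mat_adjoint (pauli_rotation s) \<in> pauli_unitaries n"
  proof (cases "e = 1")
    case True
    then show ?thesis using pauli_rotation_commuting[OF assms(2) xc] e x by simp
  next
    case False
    then have "pauli_rotation s * x * mat_adjoint (pauli_rotation s) = \<i> \<cdot>\<^sub>m (s * x)"
      using pauli_rotation_anticommuting[OF assms(2) xc] e by simp
    also have "\<dots> = (\<i> \<cdot>\<^sub>m 1\<^sub>m (2 ^ n)) * (s * x)"
      using pauli_strings_carrier[OF assms(2)] xc by (simp add: mult_smult_assoc_mat[of _ "2 ^ n" "2 ^ n" _ "2 ^ n"])
    also have "\<dots> \<in> pauli_unitaries n"
      using pauli_unitary_mult[OF imaginary_unit_generated[OF assms(1)] pauli_unitary_mult[OF sQ x]] .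
    finally show ?thesis .
  qed
qed

section \<open>Passing to the quotient by global phases\<close>

text \<open>A concrete form of the cosets of the global phases, convenient because it does not mention
  the dimension.\<close>
definition phase_coset :: "complex mat \<Rightarrow> complex mat set" where
  "phase_coset A = {c \<cdot>\<^sub>m A | c. cmod c = 1}"

lemma phase_coset_eq_iff: "phase_coset A = phase_coset B \<longleftrightarrow> (\<exists>c. cmod c = 1 \<and> A = c \<cdot>\<^sub>m B)"
proof
  have "A \<in> phase_coset A" unfolding phase_coset_def by (auto intro!: exI[of _ 1])
  moreover assume "phase_coset A = phase_coset B"
  ultimately show "\<exists>c. cmod c = 1 \<and> A = c \<cdot>\<^sub>m B" unfolding phase_coset_def by blast
next
  assume "\<exists>c. cmod c = 1 \<and> A = c \<cdot>\<^sub>m B"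
  then obtain c where c: "cmod c = 1" "A = c \<cdot>\<^sub>m B" by blast
  then have "c \<noteq> 0" by auto
  show "phase_coset A = phase_coset B"
  proof (intro equalityI subsetI)
    fix x assume "x \<in> phase_coset A"
    then obtain d where "cmod d = 1" "x = (d * c) \<cdot>\<^sub>m B"
      unfolding phase_coset_def c(2) by (auto simp: smult_smult_mat)
    then show "x \<in> phase_coset B" unfolding phase_coset_def using c(1) by (auto simp: norm_mult)
  next
    fix x assume "x \<in> phase_coset B"
    then obtain d where d: "cmod d = 1" "x = d \<cdot>\<^sub>m B" unfolding phase_coset_def by auto
    then have "x = (d / c) \<cdot>\<^sub>m A" "cmod (d / c) = 1"
      using c \<open>c \<noteq> 0\<close> by (simp_all add: smult_smult_mat norm_divide)
    then show "x \<in> phase_coset A" unfolding phase_coset_def by blast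
  qed
qed

lemma phase_coset_smult: "cmod c = 1 \<Longrightarrow> phase_coset (c \<cdot>\<^sub>m A) = phase_coset A"
  by (auto simp: phase_coset_eq_iff)

lemma global_phases_eq: "global_phases n = phase_coset (1\<^sub>m (2 ^ n))"
  by (simp add: global_phases_def phase_coset_def)

lemma r_coset_global_phases:
  assumes "A \<in> carrier_mat (2 ^ n) (2 ^ n)"
  shows "global_phases n #>\<^bsub>unitary_group (2 ^ n)\<^esub> A = phase_coset A"
proof -
  have "(c \<cdot>\<^sub>m 1\<^sub>m (2 ^ n)) * A = c \<cdot>\<^sub>m A" for c :: complex
    using assms by (simp add: mult_smult_assoc_mat[of _ "2 ^ n" "2 ^ n" _ "2 ^ n"])
  then show ?thesis unfolding r_coset_def global_phases_def phase_coset_def by auto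
qed

lemma phase_coset_mult:
  assumes "A \<in> carrier_mat (2 ^ n) (2 ^ n)" "B \<in> carrier_mat (2 ^ n) (2 ^ n)"
  shows "phase_coset A <#>\<^bsub>unitary_group (2 ^ n)\<^esub> phase_coset B = phase_coset (A * B)"
proof (intro equalityI subsetI)
  fix x assume "x \<in> phase_coset A <#>\<^bsub>unitary_group (2 ^ n)\<^esub> phase_coset B"
  then obtain c d where "cmod c = 1" "cmod d = 1" "x = (c \<cdot>\<^sub>m A) * (d \<cdot>\<^sub>m B)"
    unfolding set_mult_def phase_coset_def by auto
  then have "x = (c * d) \<cdot>\<^sub>m (A * B)" "cmod (c * d) = 1"
    using smult_mult_smult_mat[OF assms] by (auto simp: norm_mult)
  then show "x \<in> phase_coset (A * B)" unfolding phase_coset_def by blast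
next
  fix x assume "x \<in> phase_coset (A * B)"
  then obtain c where c: "cmod c = 1" "x = (c \<cdot>\<^sub>m A) * (1 \<cdot>\<^sub>m B)"
    unfolding phase_coset_def using smult_mult_smult_mat[OF assms, of _ 1] by auto
  have "c \<cdot>\<^sub>m A \<in> phase_coset A" "1 \<cdot>\<^sub>m B \<in> phase_coset B"
    using c(1) unfolding phase_coset_def by (blast, force)
  then show "x \<in> phase_coset A <#>\<^bsub>unitary_group (2 ^ n)\<^esub> phase_coset B"
    unfolding set_mult_def c(2) by auto
qed

lemma global_phases_normal:
  assumes "n \<ge> 1"
  shows "global_phases n \<lhd> unitary_group (2 ^ n)\<lparr>carrier := clifford_unitaries n\<rparr>"
proof (rule group.normal_restrict_supergroup[OF unitary_group_group clifford_subgroup[OF assms]])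
  let ?N = "2 ^ n :: nat" and ?U = "unitary_group (2 ^ n)"
  have scalar: "(c \<cdot>\<^sub>m 1\<^sub>m ?N) * A = c \<cdot>\<^sub>m A" "A * (c \<cdot>\<^sub>m 1\<^sub>m ?N) = c \<cdot>\<^sub>m A"
    if "A \<in> carrier_mat ?N ?N" for c :: complex and A
    using that by (simp_all add: mult_smult_assoc_mat[of _ ?N ?N _ ?N] mult_smult_distrib[of _ ?N ?N _ ?N])
  have unit: "c * cnj c = 1" "cnj c * c = 1" if "cmod c = 1" for c
    using that by (simp_all add: complex_norm_square[symmetric] mult.commute)
  have adj: "mat_adjoint (c \<cdot>\<^sub>m 1\<^sub>m ?N :: complex mat) = cnj c \<cdot>\<^sub>m 1\<^sub>m ?N" for c
    by (simp add: mat_adjoint_smult)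
  have U: "c \<cdot>\<^sub>m 1\<^sub>m ?N \<in> carrier ?U" if "cmod c = 1" for c
    using unit[OF that] by (simp add: adj scalar smult_smult_mat)
  have sub: "subgroup (global_phases n) ?U"
  proof (rule group.subgroupI[OF unitary_group_group])
    show "global_phases n \<subseteq> carrier ?U" using U by (auto simp: global_phases_def)
    show "global_phases n \<noteq> {}" by (auto simp: global_phases_def intro: exI[of _ 1])
    fix x assume "x \<in> global_phases n"
    then obtain c where c: "x = c \<cdot>\<^sub>m 1\<^sub>m ?N" "cmod c = 1" by (auto simp: global_phases_def)
    have "inv\<^bsub>?U\<^esub> x = cnj c \<cdot>\<^sub>m 1\<^sub>m ?N" using unitary_group_inv[OF U[OF c(2)]] by (simp add: c(1) adj)
    then show "inv\<^bsub>?U\<^esub> x \<in> global_phases n" using c(2) by (auto simp: global_phases_def)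
    fix y assume "y \<in> global_phases n"
    then obtain d where d: "y = d \<cdot>\<^sub>m 1\<^sub>m ?N" "cmod d = 1" by (auto simp: global_phases_def)
    have "x \<otimes>\<^bsub>?U\<^esub> y = (c * d) \<cdot>\<^sub>m 1\<^sub>m ?N" by (simp add: c d scalar smult_smult_mat mult.commute)
    then show "x \<otimes>\<^bsub>?U\<^esub> y \<in> global_phases n" using c(2) d(2) by (auto simp: global_phases_def norm_mult)
  qed
  show "global_phases n \<lhd> ?U"
    unfolding group.normal_inv_iff[OF unitary_group_group]
  proof (intro conjI sub ballI)
    fix A x assume A: "A \<in> carrier ?U" and x: "x \<in> global_phases n"
    then obtain c where c: "x = c \<cdot>\<^sub>m 1\<^sub>m ?N" "cmod c = 1" by (auto simp: global_phases_def)
    have "A * x * mat_adjoint A = c \<cdot>\<^sub>m 1\<^sub>m ?N"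
      using A by (simp add: c(1) scalar mult_smult_assoc_mat[of _ ?N ?N _ ?N])
    then show "A \<otimes>\<^bsub>?U\<^esub> x \<otimes>\<^bsub>?U\<^esub> inv\<^bsub>?U\<^esub> A \<in> global_phases n"
      using unitary_group_inv[OF A] x c by simp
  qed
  show "global_phases n \<subseteq> clifford_unitaries n"
  proof
    fix x assume x: "x \<in> global_phases n"
    then obtain c where c: "x = c \<cdot>\<^sub>m 1\<^sub>m ?N" "cmod c = 1" by (auto simp: global_phases_def)
    have "x * y * mat_adjoint x = y" if "y \<in> carrier_mat ?N ?N" for y
      using that unit[OF c(2)] by (simp add: c(1) adj scalar smult_smult_mat)
    then show "x \<in> clifford_unitaries n"
      using U[OF c(2)] pauli_unitary_unitary[of _ n] by (simp add: clifford_iff c(1))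
  qed
qed

lemma clifford_group_carrier: "carrier (clifford_group n) = phase_coset ` clifford_unitaries n"
  unfolding clifford_group_def carrier_FactGroup
  by (auto simp: r_coset_global_phases[OF clifford_carrier] intro!: image_cong)

lemma clifford_group_mult:
  assumes "A \<in> clifford_unitaries n" "B \<in> clifford_unitaries n"
  shows "phase_coset A \<otimes>\<^bsub>clifford_group n\<^esub> phase_coset B = phase_coset (A * B)"
  using phase_coset_mult[OF clifford_carrier clifford_carrier] assms by (simp add: clifford_group_def)

lemma clifford_group_one: "\<one>\<^bsub>clifford_group n\<^esub> = phase_coset (1\<^sub>m (2 ^ n))"
  by (simp add: clifford_group_def global_phases_eq)

lemma clifford_group_group: "n \<ge> 1 \<Longrightarrow> group (clifford_group n)"
  unfolding clifford_group_def by (rule normal.factorgroup_is_group[OF global_phases_normal])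

lemma clifford_adjoint:
  assumes "n \<ge> 1" "A \<in> clifford_unitaries n"
  shows "mat_adjoint A \<in> clifford_unitaries n"
  using subgroup.m_inv_closed[OF clifford_subgroup[OF assms(1)] assms(2)] unitary_group_inv[of A "2 ^ n"] assms(2)
  by (simp add: clifford_iff)

lemma clifford_mult:
  assumes "n \<ge> 1" "A \<in> clifford_unitaries n" "B \<in> clifford_unitaries n"
  shows "A * B \<in> clifford_unitaries n"
  using subgroup.m_closed[OF clifford_subgroup[OF assms(1)] assms(2,3)] by simp

lemma clifford_group_inv:
  assumes "n \<ge> 1" "A \<in> clifford_unitaries n"
  shows "inv\<^bsub>clifford_group n\<^esub> (phase_coset A) = phase_coset (mat_adjoint A)"
  using assms clifford_adjoint[OF assms]
  by (intro group.inv_equality[OF clifford_group_group])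
    (auto simp: clifford_group_mult clifford_group_one clifford_group_carrier clifford_iff)

lemma clifford_group_conj:
  assumes "n \<ge> 1" "A \<in> clifford_unitaries n" "B \<in> clifford_unitaries n"
  shows "phase_coset A \<otimes>\<^bsub>clifford_group n\<^esub> phase_coset B \<otimes>\<^bsub>clifford_group n\<^esub> inv\<^bsub>clifford_group n\<^esub> (phase_coset A)
    = phase_coset (A * B * mat_adjoint A)"
  using assms clifford_adjoint clifford_mult by (simp add: clifford_group_inv clifford_group_mult)

lemma pauli_group_eq: "pauli_group n = phase_coset ` pauli_unitaries n"
  unfolding pauli_group_def using r_coset_global_phases pauli_unitary_unitary by (intro image_cong) auto

lemma pauli_group_eq_strings:
  assumes "n \<ge> 1"
  shows "pauli_group n = phase_coset ` pauli_strings n"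
proof (intro equalityI subsetI)
  fix a assume "a \<in> pauli_group n"
  then obtain x where "x \<in> pauli_unitaries n" "a = phase_coset x" unfolding pauli_group_eq by blast
  then show "a \<in> phase_coset ` pauli_strings n"
    using phase_coset_smult fourth_roots_norm by (metis pauli_unitary_cases[OF assms] imageI)
next
  fix a assume "a \<in> phase_coset ` pauli_strings n"
  then show "a \<in> pauli_group n" unfolding pauli_group_eq using pauli_strings_subset_unitaries by blast
qed

text \<open>The symplectic form on the Pauli group. Scalars do not affect commutation, so any choice of
  representatives may be tested; quantifying over representatives avoids choosing one.\<close>
definition noncommuting :: "complex mat set \<Rightarrow> complex mat set \<Rightarrow> bool" where
  "noncommuting U V \<longleftrightarrow> (\<exists>A\<in>U. \<exists>B\<in>V. A * B \<noteq> B * A)"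

lemma noncommuting_iff:
  assumes "A \<in> carrier_mat N N" "B \<in> carrier_mat N N"
  shows "noncommuting (phase_coset A) (phase_coset B) \<longleftrightarrow> A * B \<noteq> B * A"
proof -
  have "(c \<cdot>\<^sub>m A) * (d \<cdot>\<^sub>m B) = (c * d) \<cdot>\<^sub>m (A * B)" "(d \<cdot>\<^sub>m B) * (c \<cdot>\<^sub>m A) = (c * d) \<cdot>\<^sub>m (B * A)" for c d
    using smult_mult_smult_mat[OF assms] smult_mult_smult_mat[OF assms(2,1)] by (simp_all add: mult.commute)
  moreover have "A \<in> phase_coset A" "B \<in> phase_coset B"
    unfolding phase_coset_def by (auto intro!: exI[of _ 1])
  ultimately show ?thesis unfolding noncommuting_def phase_coset_def by fastforce
qed

lemma commute_sign_eq_one_iff: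
  assumes "x \<in> carrier (unitary_group N)" "y \<in> carrier (unitary_group N)" "0 < N"
    and "x * y = e \<cdot>\<^sub>m (y * x)"
  shows "x * y = y * x \<longleftrightarrow> e = 1"
proof
  assume "x * y = y * x"
  define M where "M = y * x"
  have M: "M \<in> carrier_mat N N" "M * mat_adjoint M = 1\<^sub>m N"
    using unitary_mult_closed[OF assms(2,1)] by (auto simp: M_def)
  have "M = e \<cdot>\<^sub>m M" using assms(4) \<open>x * y = y * x\<close> by (simp add: M_def)
  then have "1\<^sub>m N = e \<cdot>\<^sub>m 1\<^sub>m N"
    using M mult_smult_assoc_mat[of M N N "mat_adjoint M" N e] by simp
  then have "(1\<^sub>m N :: complex mat) $$ (0, 0) = (e \<cdot>\<^sub>m 1\<^sub>m N) $$ (0, 0)" by simp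
  then show "e = 1" using assms(3) by simp
qed (use assms in simp)

section \<open>Three commuting independent Pauli strings\<close>

text \<open>The diagonal strings acting by \<open>Z\<close> or the identity on the first three qubits; they form a
  totally isotropic space of dimension three.\<close>
definition z_string :: "nat \<Rightarrow> bool \<Rightarrow> bool \<Rightarrow> bool \<Rightarrow> complex mat" where
  "z_string m p q r = kronecker (if p then pauli_Z else 1\<^sub>m 2) (kronecker (if q then pauli_Z else 1\<^sub>m 2)
     (kronecker (if r then pauli_Z else 1\<^sub>m 2) (1\<^sub>m (2 ^ m))))"

lemma z_string_string: "z_string m p q r \<in> pauli_strings (Suc (Suc (Suc m)))"
  unfolding z_string_def by (intro kronecker_string) auto

lemma z_string_mult:
  "z_string m p q r * z_string m p' q' r' = z_string m (p \<noteq> p') (q \<noteq> q') (r \<noteq> r')"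
proof -
  let ?z = "\<lambda>p. if p then pauli_Z else 1\<^sub>m 2"
  have z: "?z p \<in> pauli_matrices" for p by simp
  have zz: "?z p * ?z p' = ?z (p \<noteq> p')" for p p' by (simp add: pauli_mult)
  have o: "(1\<^sub>m (2 ^ m) :: complex mat) \<in> pauli_strings m" by (rule one_pauli_string)
  have s1: "kronecker (?z r) (1\<^sub>m (2 ^ m)) \<in> pauli_strings (Suc m)" for r
    using z o by (rule kronecker_string)
  have s2: "kronecker (?z q) (kronecker (?z r) (1\<^sub>m (2 ^ m))) \<in> pauli_strings (Suc (Suc m))" for q r
    using z s1 by (rule kronecker_string)
  show ?thesis
    unfolding z_string_def pauli_strings_mult_kronecker[OF z z s2 s2] pauli_strings_mult_kronecker[OF z z s1 s1]
      pauli_strings_mult_kronecker[OF z z o o] zz by simp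
qed

text \<open>The sign of each tensor factor is read off on the diagonal, at the index in which only the
  corresponding bit is set.\<close>
lemma z_string_eq_scalar:
  assumes "z_string m p q r = c \<cdot>\<^sub>m 1\<^sub>m (2 ^ Suc (Suc (Suc m)))"
  shows "\<not> p \<and> \<not> q \<and> \<not> r"
proof -
  let ?M = "2 ^ m :: nat"
  let ?z = "\<lambda>p. if p then pauli_Z else 1\<^sub>m 2"
  have z: "?z p $$ (0, 0) = 1" "?z p $$ (Suc 0, Suc 0) = (if p then -1 else 1)"
    "dim_row (?z p) = 2" "dim_col (?z p) = 2" for p by auto
  have entry: "z_string m p q r $$ (i, i) = c" if "i < 8 * ?M" for i
    using that by (simp add: assms)
  have M: "0 < ?M" by simp
  have "z_string m p q r $$ (0, 0) = 1"
    unfolding z_string_def by (simp add: kronecker_index z)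
  moreover have "z_string m p q r $$ (4 * ?M, 4 * ?M) = (if p then -1 else 1)"
    unfolding z_string_def by (simp add: kronecker_index z)
  moreover have "z_string m p q r $$ (2 * ?M, 2 * ?M) = (if q then -1 else 1)"
    unfolding z_string_def by (simp add: kronecker_index z)
  moreover have "z_string m p q r $$ (?M, ?M) = (if r then -1 else 1)"
    unfolding z_string_def by (simp add: kronecker_index z)
  ultimately show ?thesis using entry[of 0] entry[of ?M] entry[of "2 * ?M"] entry[of "4 * ?M"] M
    by (auto split: if_splits)
qed

section \<open>Normal subgroups of the Clifford group\<close>

text \<open>Commutation signs multiply, so the form is bilinear, and conjugation preserves them. Pauli
  rotations supply the transvections, and an element centralizing the Pauli group commutes with
  every string up to a phase, hence is a string up to a phase.\<close>
lemma clifford_symplectic_extension: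
  assumes "n \<ge> 3"
  shows "symplectic_extension (clifford_group n) (pauli_group n) noncommuting"
proof -
  let ?N = "2 ^ n :: nat" and ?S = "pauli_strings n" and ?G = "clifford_group n"
  have n: "n \<ge> 1" using assms by simp
  interpret group ?G using clifford_group_group[OF n] .
  note sq = assoc_mult_mat[of _ ?N ?N _ ?N _ ?N] mult_carrier_mat[of _ ?N ?N _ ?N]
  note P = pauli_group_eq_strings[OF n]
  have PQ: "phase_coset x \<in> pauli_group n" if "x \<in> pauli_unitaries n" for x
    using that unfolding pauli_group_eq by blast
  have SQ: "s \<in> pauli_unitaries n" if "s \<in> ?S" for s using that pauli_strings_subset_unitaries by blast
  have SK: "s \<in> clifford_unitaries n" if "s \<in> ?S" for s using that SQ pauli_unitary_clifford by blast
  have SU: "s \<in> carrier (unitary_group ?N)" if "s \<in> ?S" for s using that pauli_string_unitary by blast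
  note Sc = pauli_strings_carrier
  have mult: "phase_coset s \<otimes>\<^bsub>?G\<^esub> phase_coset t = phase_coset (s * t)" if "s \<in> ?S" "t \<in> ?S" for s t
    using that SK clifford_group_mult by blast
  have nc: "noncommuting (phase_coset s) (phase_coset t) \<longleftrightarrow> s * t \<noteq> t * s" if "s \<in> ?S" "t \<in> ?S" for s t
    using that Sc noncommuting_iff by blast
  have adj: "mat_adjoint s = s" if "s \<in> ?S" for s using that by (rule pauli_strings_hermitian)
  have N: "0 < ?N" by simp
  have square: "phase_coset s \<otimes>\<^bsub>?G\<^esub> phase_coset s = \<one>\<^bsub>?G\<^esub>" if "s \<in> ?S" for s
    using that by (simp add: mult pauli_strings_square clifford_group_one)
  have sub: "subgroup (pauli_group n) ?G"
  proof (rule subgroupI)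
    show "pauli_group n \<subseteq> carrier ?G" unfolding P clifford_group_carrier using SK by blast
    show "pauli_group n \<noteq> {}" unfolding P using one_pauli_string by blast
    fix a assume "a \<in> pauli_group n"
    then obtain s where s: "s \<in> ?S" "a = phase_coset s" unfolding P by blast
    then have "inv\<^bsub>?G\<^esub> a = a" using clifford_group_inv[OF n SK[OF s(1)]] adj by simp
    then show "inv\<^bsub>?G\<^esub> a \<in> pauli_group n" using \<open>a \<in> pauli_group n\<close> by simp
    fix b assume "b \<in> pauli_group n"
    then obtain t where t: "t \<in> ?S" "b = phase_coset t" unfolding P by blast
    show "a \<otimes>\<^bsub>?G\<^esub> b \<in> pauli_group n"
      using PQ[OF pauli_unitary_mult[OF SQ SQ]] s t mult by simp
  qed
  show ?thesis
  proof (intro symplectic_extension.intro symplectic_extension_axioms.intro)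
    show "group ?G" by (rule is_group)
    show "subgroup (pauli_group n) ?G" by (rule sub)
    show "finite (pauli_group n)" unfolding P using finite_pauli_strings by blast
    show "a \<otimes>\<^bsub>?G\<^esub> a = \<one>\<^bsub>?G\<^esub>" if "a \<in> pauli_group n" for a
      using that square unfolding P by blast
  next
    fix g a assume "g \<in> carrier ?G" "a \<in> pauli_group n"
    then obtain A s where "g = phase_coset A" "A \<in> clifford_unitaries n" "a = phase_coset s" "s \<in> ?S"
      unfolding P clifford_group_carrier by blast
    then show "g \<otimes>\<^bsub>?G\<^esub> a \<otimes>\<^bsub>?G\<^esub> inv\<^bsub>?G\<^esub> g \<in> pauli_group n"
      using SQ SK PQ by (simp add: clifford_group_conj[OF n] clifford_iff)
  next
    fix a b c assume "a \<in> pauli_group n" "b \<in> pauli_group n" "c \<in> pauli_group n"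
    then obtain s t u where stu: "a = phase_coset s" "s \<in> ?S" "b = phase_coset t" "t \<in> ?S"
      "c = phase_coset u" "u \<in> ?S" unfolding P by blast
    obtain e where e: "e \<in> {1, -1}" "s * u = e \<cdot>\<^sub>m (u * s)" using pauli_strings_commute_sign stu by blast
    obtain f where f: "f \<in> {1, -1}" "t * u = f \<cdot>\<^sub>m (u * t)" using pauli_strings_commute_sign stu by blast
    note car = Sc[OF stu(2)] Sc[OF stu(4)] Sc[OF stu(6)]
    have "s * t * u = s * (t * u)" using car by (simp add: sq)
    also have "\<dots> = f \<cdot>\<^sub>m (s * u * t)"
      using car by (simp add: f(2) sq mult_smult_distrib[of _ ?N ?N _ ?N])
    also have "\<dots> = (e * f) \<cdot>\<^sub>m (u * (s * t))"
      using car by (simp add: e(2) sq mult_smult_assoc_mat[of _ ?N ?N _ ?N] smult_smult_mat mult.commute)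
    finally have "s * t * u = u * (s * t) \<longleftrightarrow> e * f = 1"
      using commute_sign_eq_one_iff[OF unitary_mult_closed[OF SU SU] SU N] stu by blast
    moreover have "s * u = u * s \<longleftrightarrow> e = 1" "t * u = u * t \<longleftrightarrow> f = 1"
      using commute_sign_eq_one_iff[OF SU SU N] e f stu by blast+
    moreover have "e * f = 1 \<longleftrightarrow> e = f" using e(1) f(1) by auto
    moreover have "noncommuting (a \<otimes>\<^bsub>?G\<^esub> b) c \<longleftrightarrow> s * t * u \<noteq> u * (s * t)"
      using stu car noncommuting_iff[of "s * t" ?N u] by (simp add: mult)
    moreover have "noncommuting a c \<longleftrightarrow> s * u \<noteq> u * s" "noncommuting b c \<longleftrightarrow> t * u \<noteq> u * t"
      using stu nc by auto
    ultimately show "noncommuting (a \<otimes>\<^bsub>?G\<^esub> b) c \<longleftrightarrow> noncommuting a c \<noteq> noncommuting b c"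
      using e(1) f(1) by auto
  next
    fix a b
    show "noncommuting a b \<longleftrightarrow> noncommuting b a" unfolding noncommuting_def by metis
  next
    fix a assume "a \<in> pauli_group n"
    then show "\<not> noncommuting a a" using nc unfolding P by auto
  next
    fix a assume "a \<in> pauli_group n" "a \<noteq> \<one>\<^bsub>?G\<^esub>"
    then obtain s where s: "a = phase_coset s" "s \<in> ?S" "s \<noteq> 1\<^sub>m ?N" unfolding P clifford_group_one by blast
    then obtain t where t: "t \<in> ?S" "s * t = (-1) \<cdot>\<^sub>m (t * s)" using pauli_strings_anticommuting by blast
    then have "s * t \<noteq> t * s" using commute_sign_eq_one_iff[OF SU SU N t(2)] s by simp
    then show "\<exists>b\<in>pauli_group n. noncommuting a b" using nc s t unfolding P by blast
  next
    fix g a b assume "g \<in> carrier ?G" "a \<in> pauli_group n" "b \<in> pauli_group n"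
    then obtain A s t where A: "g = phase_coset A" "A \<in> clifford_unitaries n" and
      st: "a = phase_coset s" "s \<in> ?S" "b = phase_coset t" "t \<in> ?S"
      unfolding P clifford_group_carrier by blast
    have Ac: "A \<in> carrier_mat ?N ?N" "mat_adjoint A \<in> carrier_mat ?N ?N" "mat_adjoint A * A = 1\<^sub>m ?N"
      using A by (auto simp: clifford_iff)
    have cancel: "mat_adjoint A * (A * x) = x" if "x \<in> carrier_mat ?N ?N" for x
      using that Ac by (simp flip: sq(1))
    let ?f = "\<lambda>x. A * x * mat_adjoint A"
    have fc: "?f x \<in> carrier_mat ?N ?N" if "x \<in> carrier_mat ?N ?N" for x using that Ac by (simp add: sq)
    have f_mult: "?f x * ?f y = ?f (x * y)" if "x \<in> carrier_mat ?N ?N" "y \<in> carrier_mat ?N ?N" for x y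
      using that Ac by (simp add: sq cancel)
    have f_inj: "?f x = ?f y \<longleftrightarrow> x = y" if "x \<in> carrier_mat ?N ?N" "y \<in> carrier_mat ?N ?N" for x y
    proof
      assume "?f x = ?f y"
      then have "mat_adjoint A * ?f x * A = mat_adjoint A * ?f y * A" by simp
      then show "x = y" using that Ac by (simp add: sq cancel)
    qed simp
    note car = Sc[OF st(2)] Sc[OF st(4)]
    have "noncommuting (phase_coset (?f s)) (phase_coset (?f t)) \<longleftrightarrow> s * t \<noteq> t * s"
      using noncommuting_iff[OF fc fc] car f_mult f_inj[of "s * t" "t * s"] by (simp add: sq(2))
    then show "noncommuting (g \<otimes>\<^bsub>?G\<^esub> a \<otimes>\<^bsub>?G\<^esub> inv\<^bsub>?G\<^esub> g) (g \<otimes>\<^bsub>?G\<^esub> b \<otimes>\<^bsub>?G\<^esub> inv\<^bsub>?G\<^esub> g) \<longleftrightarrow> noncommuting a b"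
      using A st SK by (simp add: clifford_group_conj[OF n] nc)
  next
    fix a assume "a \<in> pauli_group n"
    then obtain s where s: "a = phase_coset s" "s \<in> ?S" unfolding P by blast
    let ?t = "pauli_rotation s"
    note tK = pauli_rotation_clifford[OF n s(2)]
    show "\<exists>t\<in>carrier ?G. \<forall>b\<in>pauli_group n.
      t \<otimes>\<^bsub>?G\<^esub> b \<otimes>\<^bsub>?G\<^esub> inv\<^bsub>?G\<^esub> t = (if noncommuting a b then a \<otimes>\<^bsub>?G\<^esub> b else b)"
    proof (intro bexI ballI)
      show "phase_coset ?t \<in> carrier ?G" using tK unfolding clifford_group_carrier by blast
      fix b assume "b \<in> pauli_group n"
      then obtain u where u: "b = phase_coset u" "u \<in> ?S" unfolding P by blast
      obtain e where e: "e \<in> {1, -1}" "s * u = e \<cdot>\<^sub>m (u * s)" using pauli_strings_commute_sign s u by blast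
      have iff: "s * u = u * s \<longleftrightarrow> e = 1" using commute_sign_eq_one_iff[OF SU SU N] e s u by blast
      have "phase_coset (?t * u * mat_adjoint ?t) = (if noncommuting a b then a \<otimes>\<^bsub>?G\<^esub> b else b)"
      proof (cases "e = 1")
        case True
        then show ?thesis using pauli_rotation_commuting[OF s(2) Sc[OF u(2)]] iff s u by (simp add: nc)
      next
        case False
        then have "?t * u * mat_adjoint ?t = \<i> \<cdot>\<^sub>m (s * u)"
          using pauli_rotation_anticommuting[OF s(2) Sc[OF u(2)]] e by simp
        then show ?thesis using False iff s u by (simp add: nc mult phase_coset_smult)
      qed
      then show "phase_coset ?t \<otimes>\<^bsub>?G\<^esub> b \<otimes>\<^bsub>?G\<^esub> inv\<^bsub>?G\<^esub> (phase_coset ?t) = (if noncommuting a b then a \<otimes>\<^bsub>?G\<^esub> b else b)"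
        using clifford_group_conj[OF n tK SK[OF u(2)]] u(1) by simp
    qed
  next
    fix g assume g: "g \<in> carrier ?G" and fix_all: "\<And>a. a \<in> pauli_group n \<Longrightarrow> g \<otimes>\<^bsub>?G\<^esub> a \<otimes>\<^bsub>?G\<^esub> inv\<^bsub>?G\<^esub> g = a"
    then obtain A where A: "g = phase_coset A" "A \<in> clifford_unitaries n" unfolding clifford_group_carrier by blast
    have Ac: "A \<in> carrier_mat ?N ?N" "mat_adjoint A \<in> carrier_mat ?N ?N" "mat_adjoint A * A = 1\<^sub>m ?N"
      "A * mat_adjoint A = 1\<^sub>m ?N"
      using A by (auto simp: clifford_iff)
    have nonzero: "A \<noteq> 0\<^sub>m ?N ?N"
    proof
      assume "A = 0\<^sub>m ?N ?N"
      then have "(1\<^sub>m ?N :: complex mat) $$ (0, 0) = (0\<^sub>m ?N ?N) $$ (0, 0)"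
        using Ac(2,4) left_mult_zero_mat[OF Ac(2)] by simp
      then show False by simp
    qed
    have "\<exists>c. A * s = c \<cdot>\<^sub>m (s * A)" if s: "s \<in> ?S" for s
    proof -
      have "phase_coset (A * s * mat_adjoint A) = phase_coset s"
        using fix_all[of "phase_coset s"] s A SK by (simp add: P clifford_group_conj[OF n])
      then obtain c where c: "A * s * mat_adjoint A = c \<cdot>\<^sub>m s" unfolding phase_coset_eq_iff by blast
      have "A * s * mat_adjoint A * A = c \<cdot>\<^sub>m (s * A)"
        using Ac Sc[OF s] unfolding c by (simp add: mult_smult_assoc_mat[of _ ?N ?N _ ?N])
      then show ?thesis using Ac Sc[OF s] by (auto simp: sq)
    qed
    then obtain c r where r: "A = c \<cdot>\<^sub>m r" "r \<in> ?S" using pauli_projective_commutant[OF Ac(1) nonzero] by blast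
    have "(c * cnj c) \<cdot>\<^sub>m 1\<^sub>m ?N = (1\<^sub>m ?N :: complex mat)"
      using Ac(4) r Sc[OF r(2)] adj[OF r(2)] pauli_strings_square[OF r(2)]
      by (simp add: mat_adjoint_smult smult_mult_smult_mat[of _ ?N])
    then have "((c * cnj c) \<cdot>\<^sub>m 1\<^sub>m ?N) $$ (0, 0) = (1\<^sub>m ?N :: complex mat) $$ (0, 0)" by simp
    then have "c * cnj c = 1" by simp
    then have "(cmod c)\<^sup>2 = 1"
      by (metis complex_norm_square of_real_eq_1_iff)
    then have "cmod c = 1"
      using norm_ge_zero[of c] by (auto simp: power2_eq_1_iff)
    then have "g = phase_coset r" using A r phase_coset_smult by simp
    then show "g \<in> pauli_group n" using r unfolding P by blast
  next
    obtain m where m: "n = Suc (Suc (Suc m))"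
      using assms by (metis Suc_le_D numeral_3_eq_3 Suc_le_mono)
    let ?z = "\<lambda>p q r. phase_coset (z_string m p q r)"
    have zS: "z_string m p q r \<in> ?S" for p q r unfolding m by (rule z_string_string)
    have zP: "?z p q r \<in> pauli_group n" for p q r using zS unfolding P by blast
    have z_mult: "?z p q r \<otimes>\<^bsub>?G\<^esub> ?z p' q' r' = ?z (p \<noteq> p') (q \<noteq> q') (r \<noteq> r')" for p q r p' q' r'
      using mult[OF zS zS] by (simp add: z_string_mult)
    have z_nc: "\<not> noncommuting (?z p q r) (?z p' q' r')" for p q r p' q' r'
    proof -
      have "z_string m p q r * z_string m p' q' r' = z_string m p' q' r' * z_string m p q r"
        by (simp only: z_string_mult neq_commute)
      then show ?thesis using nc[OF zS zS] by blast
    qed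
    have z_one: "?z p q r = \<one>\<^bsub>?G\<^esub> \<Longrightarrow> \<not> p \<and> \<not> q \<and> \<not> r" for p q r
      unfolding clifford_group_one phase_coset_eq_iff using z_string_eq_scalar[of m p q r] by (auto simp: m)
    let ?u = "?z True False False" and ?v = "?z False True False" and ?w = "?z False False True"
    show "\<exists>u\<in>pauli_group n. \<exists>v\<in>pauli_group n. \<exists>w\<in>pauli_group n.
        \<not> noncommuting u v \<and> \<not> noncommuting u w \<and> \<not> noncommuting v w \<and>
        u \<noteq> \<one>\<^bsub>?G\<^esub> \<and> v \<noteq> \<one>\<^bsub>?G\<^esub> \<and> u \<otimes>\<^bsub>?G\<^esub> v \<noteq> \<one>\<^bsub>?G\<^esub> \<and>
        w \<noteq> \<one>\<^bsub>?G\<^esub> \<and> u \<otimes>\<^bsub>?G\<^esub> w \<noteq> \<one>\<^bsub>?G\<^esub> \<and> v \<otimes>\<^bsub>?G\<^esub> w \<noteq> \<one>\<^bsub>?G\<^esub> \<and> u \<otimes>\<^bsub>?G\<^esub> v \<otimes>\<^bsub>?G\<^esub> w \<noteq> \<one>\<^bsub>?G\<^esub>"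
      by (rule bexI[OF _ zP[of True False False]], rule bexI[OF _ zP[of False True False]],
          rule bexI[OF _ zP[of False False True]], unfold z_mult) (use z_nc z_one in blast)
  qed
qed

theorem theorem5p5:
  fixes n :: nat
  assumes "n \<ge> 3"
  shows "{N. N \<lhd> clifford_group n \<and> N \<noteq> {\<one>\<^bsub>clifford_group n\<^esub>} \<and> N \<noteq> carrier (clifford_group n)}
           = {pauli_group n}"
  using symplectic_extension.normal_subgroups[OF clifford_symplectic_extension[OF assms]] .

end
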